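(* For a Platonic solid $\mathcal{P}$ let $F_{\mathcal{P}}=\sum_{F\in F(\mathcal{P})}\prod_{v\in F}x_v$ and let $A_{\mathcal{P}}=\mathbb{R}[\partial_v\mid v\in V(\mathcal{P})]/\operatorname{Ann}(F_{\mathcal{P}})$ be the associated graded Artinian Gorenstein algebra, equipped with its Poincaré duality $P_{F_{\mathcal{P}}}$. Then the following hold. (i) For each of the five Platonic solids $\mathcal{P}$ (regular tetrahedron, hexahedron, octahedron, dodecahedron, icosahedron), the algebra $A_{\mathcal{P}}$ has the strong Lefschetz property. (ii) If $\mathcal{P}$ is the regular tetrahedron or the regular octahedron, then $A_{\mathcal{P}}$ satisfies the Hodge--Riemann relation on the positive orthant, i.e. with respect to $\ell_{\boldsymbol a}=\sum_{v\in V(\mathcal{P})}a_v\partial_v$ for every $\boldsymbol a=(a_v)_v$ with all $a_v>0$. If $\mathcal{P}$ is the regular hexahedron, the regular dodecahedron or the regular icosahedron, then there is a strong Lefschetz element $\ell\in (A_{\mathcal{P}})_1$ such that $A_{\mathcal{P}}$ does not satisfy the Hodge--Riemann relation with respect to $\ell$.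
   Context: For a polyhedron $\mathcal{P}$, $V(\mathcal{P})$ is the set of vertices and $F(\mathcal{P})$ the set of ($2$-dimensional) faces, each face being regarded as the subset of $V(\mathcal{P})$ consisting of its vertices. Explicitly, the vertices may be labelled so that: Tetrahedron ($4$ vertices): $F(\mathcal{P})=\{\{1,2,3\},\{1,2,4\},\{1,3,4\},\{2,3,4\}\}$. Hexahedron ($8$ vertices): $F(\mathcal{P})=\{\{1,2,3,4\},\{2,3,6,7\},\{3,4,7,8\},\{1,4,5,8\},\{1,2,5,6\},\{5,6,7,8\}\}$. Octahedron ($6$ vertices): $F(\mathcal{P})=\{\{1,2,3\},\{1,3,4\},\{1,4,5\},\{1,2,5\},\{2,3,6\},\{3,4,6\},\{4,5,6\},\{2,5,6\}\}$. Dodecahedron ($20$ vertices): $F(\mathcal{P})=\{\{1,2,3,4,5\},\{1,2,6,7,19\},\{2,3,7,8,20\},\{3,4,8,9,16\},\{4,5,9,10,17\},\{1,5,6,10,18\},\{11,12,13,14,15\},\{11,12,16,17,9\},\{12,13,17,18,10\},\{13,14,18,19,6\},\{14,15,19,20,7\},\{11,15,16,20,8\}\}$. Icosahedron ($12$ vertices): $F(\mathcal{P})=\{\{1,2,3\},\{1,3,4\},\{1,4,5\},\{3,4,9\},\{1,5,6\},\{1,2,6\},\{2,3,8\},\{3,8,9\},\{2,6,7\},\{2,7,8\},\{10,11,12\},\{4,5,10\},\{4,9,10\},\{5,6,11\},\{5,10,11\},\{9,10,12\},\{8,9,12\},\{6,7,11\},\{7,11,12\},\{7,8,12\}\}$.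 $\partial_v=\partial/\partial x_v$; the polynomial ring $\mathbb{R}[\partial_v\mid v\in V(\mathcal{P})]$ acts on $\mathbb{R}[x_v\mid v\in V(\mathcal{P})]$ by differentiation, and $\operatorname{Ann}(F)=\{f: fF=0\}$, a homogeneous ideal when $F$ is homogeneous. The quotient $A=A_{\mathcal{P}}=\bigoplus_{k=0}^s A_k$ is graded by degree, with $s=\deg F_{\mathcal{P}}$ (the number of vertices of a face). The Poincaré duality consists of the bilinear maps $P^k_{F_{\mathcal{P}}}:A_k\times A_{s-k}\to\mathbb{R}$, $(f,g)\mapsto fgF_{\mathcal{P}}$. $A$ has the strong Lefschetz property if there is $\ell\in A_1$ such that $\times\ell^{s-2k}:A_k\to A_{s-k}$ is bijective for every integer $0\le k\le s/2$; such an $\ell$ is called a strong Lefschetz element. $A$ satisfies the Hodge--Riemann relation with respect to $\ell\in A_1$ if for every integer $0\le k\le s/2$ the symmetric bilinear form $Q^k_\ell:A_k\times A_k\to\mathbb{R}$, $(f,g)\mapsto(-1)^kP^k_{F_{\mathcal{P}}}(f,\ell^{s-2k}g)$, is positive definite on the kernel of $\times\ell^{s-2k+1}:A_k\to A_{s-k+1}$ (with $A_{s+1}=0$). *)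

theory Defs
  imports Complex_Main "HOL-Library.Poly_Mapping" "HOL-Algebra.QuotRing"
begin

section \<open>The face structure of the Platonic solids\<close>

datatype platonic = Tetrahedron | Hexahedron | Octahedron | Dodecahedron | Icosahedron

fun vertices :: "platonic \<Rightarrow> nat set" where
  "vertices Tetrahedron = {1..4}"
| "vertices Hexahedron = {1..8}"
| "vertices Octahedron = {1..6}"
| "vertices Dodecahedron = {1..20}"
| "vertices Icosahedron = {1..12}"

fun faces :: "platonic \<Rightarrow> nat set set" where
  "faces Tetrahedron = {{1,2,3}, {1,2,4}, {1,3,4}, {2,3,4}}"
| "faces Hexahedron =
    {{1,2,3,4}, {2,3,6,7}, {3,4,7,8}, {1,4,5,8}, {1,2,5,6}, {5,6,7,8}}"
| "faces Octahedron =
    {{1,2,3}, {1,3,4}, {1,4,5}, {1,2,5}, {2,3,6}, {3,4,6}, {4,5,6}, {2,5,6}}"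
| "faces Dodecahedron =
    {{1,2,3,4,5}, {1,2,6,7,19}, {2,3,7,8,20}, {3,4,8,9,16}, {4,5,9,10,17}, {1,5,6,10,18},
     {11,12,13,14,15}, {11,12,16,17,9}, {12,13,17,18,10}, {13,14,18,19,6}, {14,15,19,20,7},
     {11,15,16,20,8}}"
| "faces Icosahedron =
    {{1,2,3}, {1,3,4}, {1,4,5}, {3,4,9}, {1,5,6}, {1,2,6}, {2,3,8}, {3,8,9}, {2,6,7}, {2,7,8},
     {10,11,12}, {4,5,10}, {4,9,10}, {5,6,11}, {5,10,11}, {9,10,12}, {8,9,12}, {6,7,11},
     {7,11,12}, {7,8,12}}"


section \<open>Real polynomials acting by differentiation\<close>

text \<open>
  A monomial is a finitely supported exponent vector \<open>nat \<Rightarrow>\<^sub>0 nat\<close>, and the multiplication of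
  \<^typ>\<open>(nat \<Rightarrow>\<^sub>0 nat) \<Rightarrow>\<^sub>0 real\<close> is the convolution product. The same type serves for the polynomials in
  the \<open>x\<^sub>v\<close> and for those in the \<open>\<partial>\<^sub>v\<close>.
\<close>

type_synonym rpoly = "(nat \<Rightarrow>\<^sub>0 nat) \<Rightarrow>\<^sub>0 real"

definition Var :: "nat \<Rightarrow> rpoly" where
  "Var v = Poly_Mapping.single (Poly_Mapping.single v 1) 1"

definition Const :: "real \<Rightarrow> rpoly" where
  "Const c = Poly_Mapping.single 0 c"

definition mon_degree :: "(nat \<Rightarrow>\<^sub>0 nat) \<Rightarrow> nat" where
  "mon_degree m = (\<Sum>v\<in>Poly_Mapping.keys m. Poly_Mapping.lookup m v)"

definition homogeneous :: "nat \<Rightarrow> rpoly \<Rightarrow> bool" where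
  "homogeneous k f \<longleftrightarrow> (\<forall>m\<in>Poly_Mapping.keys f. mon_degree m = k)"

text \<open>The total degree; the zero polynomial is given degree \<open>0\<close>.\<close>

definition total_degree :: "rpoly \<Rightarrow> nat" where
  "total_degree f = Max (insert 0 (mon_degree ` Poly_Mapping.keys f))"

text \<open>
  The subtraction of exponent vectors is truncated at \<open>0\<close>, which is harmless since the coefficient
  then vanishes.
\<close>

definition partial_deriv :: "nat \<Rightarrow> rpoly \<Rightarrow> rpoly" where
  "partial_deriv v F = (\<Sum>m\<in>Poly_Mapping.keys F.
     Poly_Mapping.single (m - Poly_Mapping.single v 1)
       (Poly_Mapping.lookup F m * real (Poly_Mapping.lookup m v)))"

text \<open>
  The operator \<open>\<Prod>\<^sub>v \<partial>\<^sub>v ^ (m v)\<close>; the partial derivatives commute, so that applying them in increasing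
  order of the variables is no restriction.
\<close>

definition mon_deriv :: "(nat \<Rightarrow>\<^sub>0 nat) \<Rightarrow> rpoly \<Rightarrow> rpoly" where
  "mon_deriv m F =
     fold (\<lambda>v. partial_deriv v ^^ Poly_Mapping.lookup m v)
       (sorted_list_of_set (Poly_Mapping.keys m)) F"

definition diff_act :: "rpoly \<Rightarrow> rpoly \<Rightarrow> rpoly" where
  "diff_act f F =
     (\<Sum>m\<in>Poly_Mapping.keys f. Const (Poly_Mapping.lookup f m) * mon_deriv m F)"


section \<open>The algebra of a homogeneous polynomial\<close>

definition poly_ring :: "nat set \<Rightarrow> rpoly ring" where
  "poly_ring V =
     \<lparr>carrier = {f. \<forall>m\<in>Poly_Mapping.keys f. Poly_Mapping.keys m \<subseteq> V},
      mult = (*), one = 1, zero = 0, add = (+)\<rparr>"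

definition Ann :: "nat set \<Rightarrow> rpoly \<Rightarrow> rpoly set" where
  "Ann V F = {f \<in> carrier (poly_ring V). diff_act f F = 0}"

definition Alg :: "nat set \<Rightarrow> rpoly \<Rightarrow> rpoly set ring" where
  "Alg V F = poly_ring V Quot Ann V F"

definition cls :: "nat set \<Rightarrow> rpoly \<Rightarrow> rpoly \<Rightarrow> rpoly set" where
  "cls V F f = Ann V F +>\<^bsub>poly_ring V\<^esub> f"

definition graded_piece :: "nat set \<Rightarrow> rpoly \<Rightarrow> nat \<Rightarrow> rpoly set set" where
  "graded_piece V F k = cls V F ` {f \<in> carrier (poly_ring V). homogeneous k f}"

text \<open>
  For \<open>x \<in> A\<^sub>k\<close> and \<open>y \<in> A\<^bsub>s-k\<^esub>\<close>, where \<open>s\<close> is the degree of \<open>F\<close>, the polynomial \<open>f g F\<close> is a constant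
  that does not depend on the choice of representatives \<open>f\<close> of \<open>x\<close> and \<open>g\<close> of \<open>y\<close>.
\<close>

definition poincare :: "rpoly \<Rightarrow> rpoly set \<Rightarrow> rpoly set \<Rightarrow> real" where
  "poincare F x y = (THE r. \<forall>f\<in>x. \<forall>g\<in>y. diff_act (f * g) F = Const r)"

definition lefschetz_map ::
    "nat set \<Rightarrow> rpoly \<Rightarrow> rpoly set \<Rightarrow> nat \<Rightarrow> rpoly set \<Rightarrow> rpoly set" where
  "lefschetz_map V F l n x = (l [^]\<^bsub>Alg V F\<^esub> n) \<otimes>\<^bsub>Alg V F\<^esub> x"

definition strong_lefschetz_element :: "nat set \<Rightarrow> rpoly \<Rightarrow> rpoly set \<Rightarrow> bool" where
  "strong_lefschetz_element V F l \<longleftrightarrow>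
     l \<in> graded_piece V F 1 \<and>
     (\<forall>k. 2 * k \<le> total_degree F \<longrightarrow>
        bij_betw (lefschetz_map V F l (total_degree F - 2 * k))
          (graded_piece V F k) (graded_piece V F (total_degree F - k)))"

definition strong_lefschetz_property :: "nat set \<Rightarrow> rpoly \<Rightarrow> bool" where
  "strong_lefschetz_property V F \<longleftrightarrow> (\<exists>l. strong_lefschetz_element V F l)"

definition hodge_riemann_form ::
    "nat set \<Rightarrow> rpoly \<Rightarrow> rpoly set \<Rightarrow> nat \<Rightarrow> rpoly set \<Rightarrow> rpoly set \<Rightarrow> real" where
  "hodge_riemann_form V F l k x y =
     (- 1) ^ k * poincare F x (lefschetz_map V F l (total_degree F - 2 * k) y)"

definition primitive_part :: "nat set \<Rightarrow> rpoly \<Rightarrow> rpoly set \<Rightarrow> nat \<Rightarrow> rpoly set set" where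
  "primitive_part V F l k =
     {x \<in> graded_piece V F k.
        lefschetz_map V F l (total_degree F - 2 * k + 1) x = \<zero>\<^bsub>Alg V F\<^esub>}"

definition hodge_riemann_relation :: "nat set \<Rightarrow> rpoly \<Rightarrow> rpoly set \<Rightarrow> bool" where
  "hodge_riemann_relation V F l \<longleftrightarrow>
     (\<forall>k. 2 * k \<le> total_degree F \<longrightarrow>
        (\<forall>x\<in>primitive_part V F l k. x \<noteq> \<zero>\<^bsub>Alg V F\<^esub> \<longrightarrow> hodge_riemann_form V F l k x x > 0))"

definition linear_form :: "nat set \<Rightarrow> (nat \<Rightarrow> real) \<Rightarrow> rpoly" where
  "linear_form V a = (\<Sum>v\<in>V. Const (a v) * Var v)"


section \<open>The face polynomial\<close>

definition face_poly :: "platonic \<Rightarrow> rpoly" where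
  "face_poly P = (\<Sum>f\<in>faces P. \<Prod>v\<in>f. Var v)"

end

theory Submission
  imports Defs
begin

text \<open>
Let \<open>F\<close> be homogeneous of degree \<open>s\<close> and \<open>L f\<close> the constant term of \<open>f F\<close>. An operator \<open>f\<close> annihilates
\<open>F\<close> exactly when \<open>L\<close> vanishes on all multiples of \<open>f\<close>, so the algebra, its multiplication and its
Poincare duality can all be read off from the linear functional \<open>L\<close>, called \<open>pairing F\<close> below. Two
general facts reduce the work. Multiplication by \<open>\<ell>\<^bsup>s-2k\<^esup>\<close> on \<open>A\<^sub>k\<close> is self-adjoint for the
duality, hence bijective as soon as it is injective (\<open>strong_lefschetz_of_injective\<close>). And the
Hodge--Riemann relation forces injectivity, because an element killed by \<open>\<ell>\<^bsup>s-2k\<^esup>\<close> is primitive and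
isotropic (\<open>strong_lefschetz_of_hodge_riemann\<close>).

If \<open>F\<close> is the face polynomial of a pure complex, \<open>L f\<close> is the sum of the coefficients of \<open>f\<close> at the
squarefree monomials of the faces. For \<open>\<ell> = \<Sum> a\<^sub>v \<partial>\<^sub>v\<close> with all \<open>a\<^sub>v\<close> nonzero, replace the coefficient
\<open>c\<^sub>P\<close> of \<open>x\<^sup>P\<close> in \<open>f\<close> by \<open>z\<^sub>P = c\<^sub>P / \<Prod>\<^bsub>v\<in>P\<^esub> a\<^sub>v\<close>. Then the condition \<open>\<ell>\<^bsup>s-2k\<^esup> f = 0\<close> becomes a linear
system for \<open>z\<close> which involves \<open>a\<close> only through the face weights \<open>w\<^sub>S = \<Prod>\<^bsub>v\<in>S\<^esub> a\<^sub>v\<close>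
(\<open>strong_lefschetz_of_weights\<close>), and the form on \<open>A\<^sub>0\<close> is \<open>s!\<close> times the sum of the \<open>w\<^sub>S\<close>.

For the tetrahedron and the octahedron \<open>s = 3\<close>, so that the Hodge--Riemann relation is the positivity of
\<open>F\<close> together with an inequality for \<open>k = 1\<close>: the Hessian of \<open>F\<close> at \<open>a\<close> is negative on the tangent
hyperplane, outside the directions along which \<open>F\<close> is constant. The octahedral polynomial is the product \<open>(x\<^sub>1+x\<^sub>6)(x\<^sub>2+x\<^sub>4)(x\<^sub>3+x\<^sub>5)\<close>, for which this is the
nonnegativity of a sum of squares; for the tetrahedron it is proved by ordering the \<open>z\<^sub>v\<close>.

For the other three solids it suffices to find \<open>a\<close> for which the linear systems have only the trivial
solution and the sum of the \<open>w\<^sub>S\<close> is negative: then the Hodge--Riemann relation fails already on \<open>A\<^sub>0\<close>.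
For the icosahedron \<open>a = -1\<close> works, because the adjacency matrix is invertible. For the hexahedron one
vertex gets the value \<open>-2\<close> and the others \<open>1\<close>. For the dodecahedron equal weights give a singular
system, so the four vertices of two opposite edges get \<open>-2\<close> and the other vertices \<open>-1\<close>. These weights
are invariant under three commuting reflections, so that every solution is a combination of
solutions which are even or odd under each of them, and for these at most six unknowns remain.
\<close>

section \<open>Differentiation as contraction\<close>

abbreviation "lookup \<equiv> Poly_Mapping.lookup"
abbreviation "keys \<equiv> Poly_Mapping.keys"
abbreviation "single \<equiv> Poly_Mapping.single"

lemma poly_as_sum_of_terms:
  fixes f :: "'a \<Rightarrow>\<^sub>0 'b::comm_monoid_add"
  shows "f = (\<Sum>m\<in>keys f. single m (lookup f m))"
proof (rule poly_mapping_eqI)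
  fix k
  have "(\<Sum>m\<in>keys f. lookup (single m (lookup f m)) k)
      = (\<Sum>m\<in>keys f. if m = k then lookup f m else 0)"
    by (intro sum.cong) (auto simp: lookup_single when_def)
  also have "\<dots> = lookup f k" by (simp add: in_keys_iff)
  finally show "lookup f k = lookup (\<Sum>m\<in>keys f. single m (lookup f m)) k"
    by (simp add: lookup_sum)
qed

abbreviation monom :: "(nat \<Rightarrow>\<^sub>0 nat) \<Rightarrow> rpoly" where
  "monom m \<equiv> single m 1"

text \<open>
The factor by which a coefficient is scaled to turn differentiation into a shift of exponents:
\<open>\<partial>\<^sup>m x\<^bsup>p+m\<^esup> = ((p+m)! / p!) x\<^sup>p\<close>.
\<close>

definition fact_weight :: "(nat \<Rightarrow>\<^sub>0 nat) \<Rightarrow> real" where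
  "fact_weight m = (\<Prod>v\<in>keys m. fact (lookup m v))"

definition dcoeff :: "rpoly \<Rightarrow> (nat \<Rightarrow>\<^sub>0 nat) \<Rightarrow> real" where
  "dcoeff F p = lookup F p * fact_weight p"

lemma fact_weight_pos: "fact_weight p > 0"
  unfolding fact_weight_def by (intro prod_pos) auto

lemma fact_weight_eq_prod:
  assumes "finite A" "keys m \<subseteq> A"
  shows "fact_weight m = (\<Prod>v\<in>A. fact (lookup m v))"
  unfolding fact_weight_def using assms
  by (intro prod.mono_neutral_left) (auto simp: in_keys_iff)

lemma fact_weight_add_single:
  "fact_weight (p + single v 1) = fact_weight p * real (lookup p v + 1)"
proof -
  define A where "A = insert v (keys p)"
  have A: "finite A" "v \<in> A" unfolding A_def by auto
  have s: "keys (p + single v 1) \<subseteq> A"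
    using keys_add[of p "single v 1"] unfolding A_def by auto
  have "fact_weight (p + single v 1)
      = (\<Prod>u\<in>A. fact (lookup (p + single v 1) u))"
    by (rule fact_weight_eq_prod[OF A(1) s])
  also have "\<dots> = fact (lookup p v + 1) * (\<Prod>u\<in>A-{v}. fact (lookup p u))"
    by (subst prod.remove[OF A])
       (auto simp: lookup_add lookup_single when_def intro!: prod.cong)
  also have "\<dots> = real (lookup p v + 1) * (fact (lookup p v) * (\<Prod>u\<in>A-{v}. fact (lookup p u)))"
    by simp
  also have "fact (lookup p v) * (\<Prod>u\<in>A-{v}. fact (lookup p u)) = fact_weight p"
    using fact_weight_eq_prod[of A p] prod.remove[OF A, of
      "\<lambda>u. fact (lookup p u) :: real"] A(1)
    by (simp add: A_def subset_insertI)
  finally show ?thesis by (simp add: mult.commute)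
qed

lemma dcoeff_eq_0_iff: "dcoeff F p = 0 \<longleftrightarrow> lookup F p = 0"
  using fact_weight_pos[of p] by (simp add: dcoeff_def)

lemma dcoeff_inject: "F = G \<longleftrightarrow> (\<forall>p. dcoeff F p = dcoeff G p)"
  using fact_weight_pos by (metis dcoeff_def less_irrefl mult_right_cancel poly_mapping_eqI)

lemma dcoeff_sum: "dcoeff (\<Sum>i\<in>I. F i) p = (\<Sum>i\<in>I. dcoeff (F i) p)"
  by (simp add: dcoeff_def lookup_sum sum_distrib_right)

lemma Const_mult_eq: "lookup (Const c * F) p = c * lookup F p"
  by (simp add: Const_def mult_map_scale_conv_mult[symmetric] map.rep_eq when_def)

lemma dcoeff_Const_mult: "dcoeff (Const c * F) p = c * dcoeff F p"
  by (simp add: dcoeff_def Const_mult_eq)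

lemma lookup_partial_deriv:
  "lookup (partial_deriv v F) p
     = lookup F (p + single v 1) * real (lookup p v + 1)"
proof -
  let ?e = "single v (1::nat)"
  have eq: "lookup (single (m - ?e) (lookup F m * real (lookup m v))) p
      = (if m = p + ?e then lookup F m * real (lookup p v + 1) else 0)" for m
  proof (cases "lookup m v = 0")
    case True
    then have "m \<noteq> p + ?e" by (auto simp: lookup_add)
    with True show ?thesis by simp
  next
    case False
    then have "m - ?e = p \<longleftrightarrow> m = p + ?e"
      by (force simp: poly_mapping_eq_iff fun_eq_iff lookup_minus lookup_add lookup_single when_def)
    then show ?thesis by (auto simp: lookup_single when_def lookup_add)
  qed
  have "lookup (partial_deriv v F) p
      = (\<Sum>m\<in>keys F. if m = p + ?e then lookup F m * real (lookup p v + 1) else 0)"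
    unfolding partial_deriv_def lookup_sum eq ..
  also have "\<dots> = lookup F (p + ?e) * real (lookup p v + 1)"
    by (simp add: in_keys_iff)
  finally show ?thesis .
qed

lemma dcoeff_partial_deriv:
  "dcoeff (partial_deriv v F) p = dcoeff F (p + single v 1)"
  by (simp add: dcoeff_def lookup_partial_deriv fact_weight_add_single del: One_nat_def)

lemma dcoeff_partial_deriv_funpow:
  "dcoeff ((partial_deriv v ^^ n) F) p = dcoeff F (p + single v n)"
proof (induction n arbitrary: p)
  case (Suc n)
  have "single v 1 + single v n = single v (Suc n)"
    by (simp flip: single_add)
  then show ?case
    using Suc[of "p + single v 1"] by (simp add: dcoeff_partial_deriv add.assoc)
qed simp

lemma dcoeff_fold_partial_deriv:
  "dcoeff (fold (\<lambda>v. partial_deriv v ^^ e v) vs F) p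
     = dcoeff F (p + (\<Sum>v\<leftarrow>vs. single v (e v)))"
  by (induction vs arbitrary: F)
     (simp_all add: dcoeff_partial_deriv_funpow add.assoc add.left_commute add.commute)

lemma dcoeff_mon_deriv: "dcoeff (mon_deriv m F) p = dcoeff F (p + m)"
proof -
  have "(\<Sum>v\<leftarrow>sorted_list_of_set (keys m). single v (lookup m v)) = m"
    using poly_as_sum_of_terms[of m] by (simp add: sum_list_distinct_conv_sum_set)
  then show ?thesis
    unfolding mon_deriv_def by (simp add: dcoeff_fold_partial_deriv)
qed

text \<open>
Each \<open>\<partial>\<^sub>v\<close> shifts the scaled coefficients by one in the exponent of \<open>v\<close>, so \<open>\<partial>\<^sup>m\<close> shifts them by \<open>m\<close>:
operators act by contraction.
\<close>

lemma dcoeff_diff_act: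
  "dcoeff (diff_act f F) p = (\<Sum>m\<in>keys f. lookup f m * dcoeff F (p + m))"
  by (simp add: diff_act_def dcoeff_sum dcoeff_Const_mult dcoeff_mon_deriv)

text \<open>
The constant term of \<open>f F\<close>. Through the multiples of \<open>f\<close> it recovers every coefficient of \<open>f F\<close>.
\<close>

definition pairing :: "rpoly \<Rightarrow> rpoly \<Rightarrow> real" where
  "pairing F f = (\<Sum>m\<in>keys f. lookup f m * dcoeff F m)"

lemma pairing_superset:
  assumes "finite A" "keys f \<subseteq> A"
  shows "pairing F f = (\<Sum>m\<in>A. lookup f m * dcoeff F m)"
  unfolding pairing_def using assms
  by (intro sum.mono_neutral_left) (auto simp: in_keys_iff)

lemma pairing_add: "pairing F (f + g) = pairing F f + pairing F g"
proof -
  define A where "A = keys f \<union> keys g"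
  have "finite A" "keys f \<subseteq> A" "keys g \<subseteq> A"
    "keys (f + g) \<subseteq> A"
    unfolding A_def using keys_add[of f g] by auto
  then show ?thesis
    by (simp add: pairing_superset[of A] lookup_add algebra_simps sum.distrib)
qed

lemma pairing_zero [simp]: "pairing F 0 = 0"
  by (simp add: pairing_def)

lemma pairing_Const_mult: "pairing F (Const c * f) = c * pairing F f"
proof -
  have "keys (Const c * f) \<subseteq> keys f"
    by (auto simp: in_keys_iff Const_mult_eq)
  then have "pairing F (Const c * f)
      = (\<Sum>m\<in>keys f. lookup (Const c * f) m * dcoeff F m)"
    by (simp add: pairing_superset)
  then show ?thesis
    by (simp add: pairing_def Const_mult_eq sum_distrib_left mult.assoc)
qed

lemma pairing_uminus: "pairing F (- f) = - pairing F f"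
  using pairing_add[of F f "- f"] by simp

lemma pairing_diff: "pairing F (f - g) = pairing F f - pairing F g"
  using pairing_add[of F f "- g"] by (simp add: pairing_uminus)

lemma pairing_sum: "pairing F (\<Sum>i\<in>I. f i) = (\<Sum>i\<in>I. pairing F (f i))"
  by (induction I rule: infinite_finite_induct) (auto simp: pairing_add)

lemma pairing_single: "pairing F (single m c) = c * dcoeff F m"
  by (simp add: pairing_def)

lemma dcoeff_diff_act_eq_pairing: "dcoeff (diff_act f F) p = pairing F (monom p * f)"
proof -
  have "monom p * f = (\<Sum>m\<in>keys f. single (p + m) (lookup f m))"
    by (subst (1) poly_as_sum_of_terms[of f]) (simp add: sum_distrib_left mult_single)
  then show ?thesis
    by (simp add: pairing_sum pairing_single dcoeff_diff_act)
qed

lemma diff_act_eq_0_iff: "diff_act f F = 0 \<longleftrightarrow> (\<forall>p. pairing F (monom p * f) = 0)"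
proof -
  have "diff_act f F = 0 \<longleftrightarrow> (\<forall>p. dcoeff (diff_act f F) p = 0)"
    by (subst dcoeff_inject) (simp add: dcoeff_def)
  then show ?thesis by (simp add: dcoeff_diff_act_eq_pairing)
qed

lemma pairing_mult_eq_0:
  assumes "diff_act f F = 0"
  shows "pairing F (g * f) = 0"
proof -
  have "g * f = (\<Sum>m\<in>keys g. Const (lookup g m) * (monom m * f))"
    by (subst (1) poly_as_sum_of_terms[of g])
       (simp add: sum_distrib_right Const_def mult_single flip: mult.assoc)
  then show ?thesis
    using assms by (simp add: pairing_sum pairing_Const_mult diff_act_eq_0_iff)
qed

section \<open>The quotient algebra\<close>

lemma mem_poly_ring_iff:
  "f \<in> carrier (poly_ring V) \<longleftrightarrow> (\<forall>m. lookup f m \<noteq> 0 \<longrightarrow> keys m \<subseteq> V)"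
  by (auto simp: poly_ring_def in_keys_iff)

lemma poly_ring_ops [simp]:
  "mult (poly_ring V) = (*)" "one (poly_ring V) = 1"
  "zero (poly_ring V) = 0" "add (poly_ring V) = (+)"
  by (simp_all add: poly_ring_def)

lemma keys_add_exponents: "keys (p + q :: nat \<Rightarrow>\<^sub>0 nat) = keys p \<union> keys q"
  by (auto simp: in_keys_iff lookup_add)

lemma poly_ring_mult_closed:
  assumes "f \<in> carrier (poly_ring V)" "g \<in> carrier (poly_ring V)"
  shows "f * g \<in> carrier (poly_ring V)"
  using assms keys_mult[of f g] unfolding poly_ring_def
  by (fastforce simp: keys_add_exponents)

lemma poly_ring_add_closed:
  "f \<in> carrier (poly_ring V) \<Longrightarrow> g \<in> carrier (poly_ring V) \<Longrightarrow> f + g \<in> carrier (poly_ring V)"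
  unfolding mem_poly_ring_iff by (auto simp: lookup_add) (metis add.right_neutral in_mono)

lemma poly_ring_zero_closed: "0 \<in> carrier (poly_ring V)"
  by (simp add: mem_poly_ring_iff)

lemma poly_ring_uminus_closed:
  "f \<in> carrier (poly_ring V) \<Longrightarrow> - f \<in> carrier (poly_ring V)"
  unfolding mem_poly_ring_iff by simp

lemma poly_ring_diff_closed:
  "f \<in> carrier (poly_ring V) \<Longrightarrow> g \<in> carrier (poly_ring V) \<Longrightarrow> f - g \<in> carrier (poly_ring V)"
  using poly_ring_add_closed[of f V "- g"] poly_ring_uminus_closed by simp

lemma poly_ring_monom_closed: "keys m \<subseteq> V \<Longrightarrow> single m c \<in> carrier (poly_ring V)"
  unfolding mem_poly_ring_iff by (simp add: lookup_single when_def)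

lemma poly_ring_Const_closed: "Const c \<in> carrier (poly_ring V)"
  unfolding Const_def by (rule poly_ring_monom_closed) simp

lemma poly_ring_one_closed: "1 \<in> carrier (poly_ring V)"
  using poly_ring_Const_closed[of 1 V] by (simp add: Const_def)

lemma poly_ring_power_closed: "f \<in> carrier (poly_ring V) \<Longrightarrow> f ^ n \<in> carrier (poly_ring V)"
  by (induction n) (auto intro: poly_ring_mult_closed poly_ring_one_closed)

lemma poly_ring_sum_closed:
  "(\<And>i. i \<in> I \<Longrightarrow> f i \<in> carrier (poly_ring V)) \<Longrightarrow> (\<Sum>i\<in>I. f i) \<in> carrier (poly_ring V)"
  by (induction I rule: infinite_finite_induct)
     (auto intro: poly_ring_add_closed poly_ring_zero_closed)

lemma cring_poly_ring: "cring (poly_ring V)"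
proof (rule cringI)
  show "abelian_group (poly_ring V)"
  proof (rule abelian_groupI)
    show "\<exists>y\<in>carrier (poly_ring V). y \<oplus>\<^bsub>poly_ring V\<^esub> x = \<zero>\<^bsub>poly_ring V\<^esub>"
      if "x \<in> carrier (poly_ring V)" for x
      using that by (intro bexI[of _ "- x"]) (auto intro: poly_ring_uminus_closed)
  qed (auto intro: poly_ring_add_closed poly_ring_zero_closed simp: algebra_simps)
  show "comm_monoid (poly_ring V)"
    by (rule comm_monoidI)
       (auto intro: poly_ring_mult_closed poly_ring_one_closed simp: algebra_simps)
qed (auto simp: algebra_simps)

lemma mem_Ann_iff:
  "f \<in> Ann V F \<longleftrightarrow> f \<in> carrier (poly_ring V) \<and> (\<forall>p. pairing F (monom p * f) = 0)"
  by (auto simp: Ann_def diff_act_eq_0_iff)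

lemma Ann_closed: "f \<in> Ann V F \<Longrightarrow> f \<in> carrier (poly_ring V)"
  by (simp add: Ann_def)

lemma pairing_Ann: "f \<in> Ann V F \<Longrightarrow> pairing F (g * f) = 0"
  by (simp add: Ann_def pairing_mult_eq_0)

lemma Ann_add: "f \<in> Ann V F \<Longrightarrow> g \<in> Ann V F \<Longrightarrow> f + g \<in> Ann V F"
  by (simp add: mem_Ann_iff poly_ring_add_closed distrib_left pairing_add)

lemma Ann_uminus: "f \<in> Ann V F \<Longrightarrow> - f \<in> Ann V F"
  by (simp add: mem_Ann_iff poly_ring_uminus_closed pairing_uminus)

lemma Ann_zero: "0 \<in> Ann V F"
  by (simp add: mem_Ann_iff mem_poly_ring_iff)

lemma Ann_mult:
  assumes "f \<in> Ann V F" "g \<in> carrier (poly_ring V)"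
  shows "g * f \<in> Ann V F"
proof -
  have "pairing F (monom p * (g * f)) = 0" for p
    using pairing_Ann[OF assms(1), of "monom p * g"] by (simp add: mult.assoc)
  then show ?thesis
    using assms by (simp add: mem_Ann_iff poly_ring_mult_closed)
qed

lemma Ann_mult_right: "f \<in> Ann V F \<Longrightarrow> g \<in> carrier (poly_ring V) \<Longrightarrow> f * g \<in> Ann V F"
  using Ann_mult[of f V F g] by (simp add: mult.commute)

lemma ideal_Ann: "ideal (Ann V F) (poly_ring V)"
proof (rule idealI)
  interpret cring "poly_ring V" by (rule cring_poly_ring)
  show "ring (poly_ring V)" by unfold_locales
  show "subgroup (Ann V F) (add_monoid (poly_ring V))"
  proof
    fix x assume x: "x \<in> Ann V F"
    then have "x \<in> carrier (poly_ring V)" by (simp add: mem_Ann_iff)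
    then have "inv\<^bsub>add_monoid (poly_ring V)\<^esub> x = - x"
      using minus_equality[of "- x" x] by (simp add: a_inv_def poly_ring_uminus_closed)
    then show "inv\<^bsub>add_monoid (poly_ring V)\<^esub> x \<in> Ann V F"
      using x by (simp add: Ann_uminus)
  qed (auto intro: Ann_zero Ann_add dest: Ann_closed)
qed (auto intro: Ann_mult Ann_mult_right)

lemma mem_cls_iff: "g \<in> cls V F f \<longleftrightarrow> g - f \<in> Ann V F"
  unfolding cls_def a_r_coset_def' by (auto simp: diff_eq_eq intro!: bexI[of _ "g - f"])

lemma self_mem_cls: "f \<in> cls V F f"
  by (simp add: mem_cls_iff Ann_zero)

lemma cls_eq_iff: "cls V F f = cls V F g \<longleftrightarrow> f - g \<in> Ann V F"
proof
  assume "cls V F f = cls V F g"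
  then show "f - g \<in> Ann V F" using self_mem_cls[of f V F] by (simp add: mem_cls_iff)
next
  assume *: "f - g \<in> Ann V F"
  show "cls V F f = cls V F g"
    unfolding set_eq_iff mem_cls_iff
    using Ann_add[OF _ *] Ann_add[OF _ Ann_uminus[OF *]]
    by (metis (no_types, lifting) add_uminus_conv_diff diff_add_cancel add_diff_eq minus_diff_eq)
qed

lemma Alg_zero: "\<zero>\<^bsub>Alg V F\<^esub> = cls V F 0"
proof -
  have "cls V F 0 = Ann V F" by (auto simp: mem_cls_iff)
  then show ?thesis by (simp add: Alg_def FactRing_def)
qed

lemma cls_eq_zero_iff: "cls V F f = \<zero>\<^bsub>Alg V F\<^esub> \<longleftrightarrow> f \<in> Ann V F"
  by (simp add: Alg_zero cls_eq_iff)

lemma Alg_mult_cls: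
  "f \<in> carrier (poly_ring V) \<Longrightarrow> g \<in> carrier (poly_ring V) \<Longrightarrow>
    cls V F f \<otimes>\<^bsub>Alg V F\<^esub> cls V F g = cls V F (f * g)"
  using ideal.rcoset_mult_add[OF ideal_Ann] by (simp add: Alg_def cls_def FactRing_def)

lemma Alg_one: "\<one>\<^bsub>Alg V F\<^esub> = cls V F 1"
  by (simp add: Alg_def cls_def FactRing_def)

lemma Alg_power_cls:
  "f \<in> carrier (poly_ring V) \<Longrightarrow> cls V F f [^]\<^bsub>Alg V F\<^esub> (n::nat) = cls V F (f ^ n)"
  by (induction n)
     (simp_all add: nat_pow_def Alg_one Alg_mult_cls poly_ring_power_closed mult.commute)

lemma lefschetz_map_cls:
  "l \<in> carrier (poly_ring V) \<Longrightarrow> f \<in> carrier (poly_ring V) \<Longrightarrow>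
    lefschetz_map V F (cls V F l) n (cls V F f) = cls V F (l ^ n * f)"
  by (simp add: lefschetz_map_def Alg_power_cls Alg_mult_cls poly_ring_power_closed)

text \<open>
Poincare duality is well defined: the product changes only by multiples of elements of the
annihilator.
\<close>

lemma pairing_cong_cls:
  assumes "f' \<in> cls V F f" "g' \<in> cls V F g" 
  shows "pairing F (h * (f' * g')) = pairing F (h * (f * g))"
proof -
  have "h * (f' * g') = h * g' * (f' - f) + h * f * (g' - g) + h * (f * g)"
    by (simp add: algebra_simps)
  moreover have "pairing F (h * g' * (f' - f)) = 0" "pairing F (h * f * (g' - g)) = 0"
    using assms pairing_Ann unfolding mem_cls_iff by blast+
  ultimately show ?thesis by (simp add: pairing_add)
qed

section \<open>Degrees and homogeneous elements\<close>

lemma mon_degree_superset: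
  assumes "finite A" "keys m \<subseteq> A"
  shows "mon_degree m = (\<Sum>v\<in>A. lookup m v)"
  unfolding mon_degree_def using assms
  by (intro sum.mono_neutral_left) (auto simp: in_keys_iff)

lemma mon_degree_add: "mon_degree (p + q) = mon_degree p + mon_degree q"
proof -
  define A where "A = keys p \<union> keys q"
  have "finite A" "keys p \<subseteq> A" "keys q \<subseteq> A" "keys (p + q) \<subseteq> A"
    unfolding A_def by (auto simp: keys_add_exponents)
  then show ?thesis by (simp add: mon_degree_superset[of A] lookup_add sum.distrib)
qed

lemma mon_degree_single [simp]: "mon_degree (single v n) = n"
  by (simp add: mon_degree_def)

lemma mon_degree_zero [simp]: "mon_degree 0 = 0"
  by (simp add: mon_degree_def)

lemma mon_degree_eq_0_iff: "mon_degree m = 0 \<longleftrightarrow> m = 0"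
  by (auto simp: mon_degree_def poly_mapping_eq_iff fun_eq_iff in_keys_iff)

lemma homogeneous_iff: "homogeneous k f \<longleftrightarrow> (\<forall>m. lookup f m \<noteq> 0 \<longrightarrow> mon_degree m = k)"
  by (auto simp: homogeneous_def in_keys_iff)

lemma homogeneous_mult:
  "homogeneous j f \<Longrightarrow> homogeneous k g \<Longrightarrow> homogeneous (j + k) (f * g)"
  using keys_mult[of f g] by (fastforce simp: homogeneous_def mon_degree_add)

lemma homogeneous_one: "homogeneous 0 1"
  by (auto simp: homogeneous_def)

lemma homogeneous_power: "homogeneous 1 l \<Longrightarrow> homogeneous n (l ^ n)"
  by (induction n) (auto intro: homogeneous_one dest: homogeneous_mult)

lemma homogeneous_single: "mon_degree m = k \<Longrightarrow> homogeneous k (single m c)"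
  by (simp add: homogeneous_def)

lemma homogeneous_Const_mult: "homogeneous k f \<Longrightarrow> homogeneous k (Const c * f)"
  by (simp add: homogeneous_iff Const_mult_eq)

lemma homogeneous_add: "homogeneous k f \<Longrightarrow> homogeneous k g \<Longrightarrow> homogeneous k (f + g)"
  unfolding homogeneous_iff by (metis add.right_neutral lookup_add)

lemma homogeneous_diff: "homogeneous k f \<Longrightarrow> homogeneous k g \<Longrightarrow> homogeneous k (f - g)"
  unfolding homogeneous_iff by (metis diff_zero lookup_minus)

lemma homogeneous_zero: "homogeneous k 0"
  by (simp add: homogeneous_iff)

lemma homogeneous_sum:
  "(\<And>i. i \<in> I \<Longrightarrow> homogeneous k (f i)) \<Longrightarrow> homogeneous k (\<Sum>i\<in>I. f i)"
  by (induction I rule: infinite_finite_induct) (auto intro: homogeneous_add homogeneous_zero)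

lemma homogeneous_prod_Var: "finite S \<Longrightarrow> homogeneous (card S) (\<Prod>v\<in>S. Var v)"
proof (induction S rule: finite_induct)
  case (insert v S)
  then show ?case
    using homogeneous_mult[of 1 "Var v" "card S" "\<Prod>v\<in>S. Var v"]
    by (simp add: Var_def homogeneous_single)
qed (simp add: homogeneous_one)

lemma poly_ring_Var_closed: "v \<in> V \<Longrightarrow> Var v \<in> carrier (poly_ring V)"
  unfolding Var_def by (rule poly_ring_monom_closed) simp

lemma linear_form_closed: "linear_form V a \<in> carrier (poly_ring V)"
  unfolding linear_form_def
  by (intro poly_ring_sum_closed poly_ring_mult_closed poly_ring_Const_closed poly_ring_Var_closed)

lemma homogeneous_linear_form: "homogeneous 1 (linear_form V a)"
  unfolding linear_form_def
  by (intro homogeneous_sum homogeneous_Const_mult) (simp add: Var_def homogeneous_single)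

lemma finite_monomials_of_degree:
  assumes "finite V"
  shows "finite {m :: nat \<Rightarrow>\<^sub>0 nat. keys m \<subseteq> V \<and> mon_degree m = k}" (is "finite ?M")
proof (rule finite_imageD)
  have "lookup m \<in> {f. \<forall>v. (v \<in> V \<longrightarrow> f v \<in> {..k}) \<and> (v \<notin> V \<longrightarrow> f v = 0)}" if "m \<in> ?M" for m
  proof -
    have "lookup m v \<le> k" if "v \<in> V" for v
      using that \<open>m \<in> ?M\<close> assms mon_degree_superset[of V m] member_le_sum[of v V
        "lookup m"] by auto
    then show ?thesis using that by (auto simp: in_keys_iff)
  qed
  then have "lookup ` ?M \<subseteq> {f. \<forall>v. (v \<in> V \<longrightarrow> f v \<in> {..k}) \<and> (v \<notin> V \<longrightarrow> f v = 0)}"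
    by (rule image_subsetI)
  then show "finite (lookup ` ?M)"
    by (rule finite_subset) (rule finite_set_of_finite_funs[OF assms finite_atMost])
  show "inj_on lookup ?M" by (intro inj_onI poly_mapping_eqI) metis
qed

section \<open>Strong Lefschetz elements and the Hodge--Riemann relation via the pairing\<close>

text \<open>
This is the solvability criterion for linear systems, in a form that needs neither bases nor
dimensions: a finite system whose right-hand side respects all linear relations has a solution. The
induction removes one functional at a time, correcting \<open>b\<close> by a multiple of it.
\<close>

lemma functional_vanishing_on_common_kernel:
  fixes \<phi> :: "'i \<Rightarrow> 'b::ab_group_add \<Rightarrow> real" and scale :: "real \<Rightarrow> 'b \<Rightarrow> 'b"
  assumes "finite I"
    and closed: "\<And>x y r. x \<in> W \<Longrightarrow> y \<in> W \<Longrightarrow> x + scale r y \<in> W"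
    and "\<And>i x y r. i \<in> I \<Longrightarrow> x \<in> W \<Longrightarrow> y \<in> W \<Longrightarrow> \<phi> i (x + scale r y) = \<phi> i x + r * \<phi> i y"
    and "\<And>x y r. x \<in> W \<Longrightarrow> y \<in> W \<Longrightarrow> b (x + scale r y) = b x + r * b y"
    and "\<And>x. x \<in> W \<Longrightarrow> (\<forall>i\<in>I. \<phi> i x = 0) \<Longrightarrow> b x = 0"
  shows "\<exists>c. \<forall>x\<in>W. b x = (\<Sum>i\<in>I. c i * \<phi> i x)"
  using assms(1,3-5)
proof (induction I arbitrary: b rule: finite_induct)
  case empty
  then show ?case by simp
next
  case (insert i I)
  note lin = insert.prems(1) and b_lin = insert.prems(2) and b_ker = insert.prems(3)
  show ?case
  proof (cases "\<forall>x\<in>W. (\<forall>j\<in>I. \<phi> j x = 0) \<longrightarrow> \<phi> i x = 0")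
    case True
    have "\<exists>c. \<forall>x\<in>W. b x = (\<Sum>j\<in>I. c j * \<phi> j x)"
      by (rule insert.IH) (use lin b_lin b_ker True in auto)
    then obtain c where c: "\<forall>x\<in>W. b x = (\<Sum>j\<in>I. c j * \<phi> j x)" by blast
    show ?thesis
      using c insert.hyps
      by (intro exI[of _ "c(i := 0)"]) (auto intro!: sum.cong)
  next
    case False
    then obtain x0 where x0: "x0 \<in> W" "\<forall>j\<in>I. \<phi> j x0 = 0"
      "\<phi> i x0 \<noteq> 0" by blast
    \<comment> \<open>The multiple of \<open>\<phi> i\<close> that makes the corrected functional vanish at \<open>x0\<close>, and with it
      on the common kernel of the remaining functionals.\<close>
    define t where "t = b x0 / \<phi> i x0"
    have "\<exists>c. \<forall>x\<in>W. b x - t * \<phi> i x = (\<Sum>j\<in>I. c j * \<phi> j x)"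
    proof (rule insert.IH)
      fix x assume x: "x \<in> W" "\<forall>j\<in>I. \<phi> j x = 0"
      let ?x = "x + scale (- \<phi> i x / \<phi> i x0) x0"
      have "\<forall>j\<in>insert i I. \<phi> j ?x = 0"
        using x x0 lin by simp
      then have "b ?x = 0"
        using b_ker closed x x0 by blast
      then show "b x - t * \<phi> i x = 0"
        using b_lin x x0 by (simp add: t_def)
    qed (use lin b_lin in \<open>auto simp: algebra_simps\<close>)
    then obtain c where c:
      "\<forall>x\<in>W. b x - t * \<phi> i x = (\<Sum>j\<in>I. c j * \<phi> j x)" by blast
    have "b x = (\<Sum>j\<in>insert i I. (c(i := t)) j * \<phi> j x)" if "x \<in> W" for x
    proof -
      have "(\<Sum>j\<in>I. (c(i := t)) j * \<phi> j x) = (\<Sum>j\<in>I. c j * \<phi> j x)"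
        using insert.hyps by (intro sum.cong) auto
      then show ?thesis
        using c[rule_format, OF that] insert.hyps by (simp del: fun_upd_apply) simp
    qed
    then show ?thesis by blast
  qed
qed

locale dual_generator =
  fixes V :: "nat set" and F :: rpoly and s :: nat
  assumes finite_V: "finite V"
    and F_closed: "F \<in> carrier (poly_ring V)"
    and F_homogeneous: "homogeneous s F"
    and F_nonzero: "F \<noteq> 0"
begin

lemma total_degree_F: "total_degree F = s"
proof -
  have "mon_degree ` keys F = (\<lambda>_. s) ` keys F"
    using F_homogeneous unfolding homogeneous_def by (intro image_cong) auto
  then have "mon_degree ` keys F = {s}"
    using F_nonzero by (simp add: image_constant_conv)
  then show ?thesis by (simp add: total_degree_def)
qed

text \<open>
Only the part of degree \<open>s\<close> contributes to the constant term of \<open>f F\<close>.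
\<close>

lemma pairing_homogeneous_eq_0:
  assumes "homogeneous j f" "j \<noteq> s"
  shows "pairing F f = 0"
  unfolding pairing_def
proof (intro sum.neutral ballI)
  fix m assume "m \<in> keys f"
  then have "lookup F m = 0"
    using assms F_homogeneous unfolding homogeneous_def by (metis in_keys_iff)
  then show "lookup f m * dcoeff F m = 0" by (simp add: dcoeff_def)
qed

lemma pairing_monom_eq_0:
  assumes "\<not> keys p \<subseteq> V"
  shows "pairing F (monom p * f) = 0"
proof -
  have "dcoeff F (p + m) = 0" for m
    using assms F_closed unfolding mem_poly_ring_iff dcoeff_eq_0_iff
    by (metis keys_add_exponents le_sup_iff)
  then show ?thesis by (simp flip: dcoeff_diff_act_eq_pairing add: dcoeff_diff_act)
qed

lemma homogeneous_monom_mult: "homogeneous k f \<Longrightarrow> homogeneous (mon_degree p + k) (monom p * f)"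
  by (intro homogeneous_mult homogeneous_single refl)

text \<open>
Monomials of a degree other than \<open>s - k\<close> are irrelevant for degree reasons, and so are those with
a variable outside \<open>V\<close>, on which \<open>F\<close> does not depend.
\<close>

lemma mem_Ann_homogeneous_iff:
  assumes "f \<in> carrier (poly_ring V)" "homogeneous k f"
  shows "f \<in> Ann V F \<longleftrightarrow>
    (\<forall>p. keys p \<subseteq> V \<and> mon_degree p + k = s \<longrightarrow> pairing F (monom p * f) = 0)"
  unfolding mem_Ann_iff
  using assms pairing_monom_eq_0 pairing_homogeneous_eq_0[OF homogeneous_monom_mult[OF assms(2)]]
  by blast

text \<open>
Surjectivity comes for free. Given \<open>h\<close> of degree \<open>s - k\<close>, an element \<open>g\<close> with \<open>\<ell>\<^bsup>s-2k\<^esup> g = h\<close> in the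
algebra is a solution of \<open>L(\<ell>\<^bsup>s-2k\<^esup> g f) = L(h f)\<close> for all \<open>f\<close> of degree \<open>k\<close>. The functional on the
right lies in the span of the functionals \<open>f \<mapsto> L(x\<^sup>m \<ell>\<^bsup>s-2k\<^esup> f)\<close> with \<open>x\<^sup>m\<close> of degree \<open>k\<close>, because their
common kernel consists of the \<open>f\<close> with \<open>\<ell>\<^bsup>s-2k\<^esup> f = 0\<close>, which vanish in the algebra.
\<close>

lemma strong_lefschetz_of_injective:
  assumes inj: "\<And>k f. 2 * k \<le> s \<Longrightarrow> f \<in> carrier (poly_ring V) \<Longrightarrow> homogeneous k f \<Longrightarrow>
      linear_form V a ^ (s - 2 * k) * f \<in> Ann V F \<Longrightarrow> f \<in> Ann V F"
  shows "strong_lefschetz_element V F (cls V F (linear_form V a))"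
  unfolding strong_lefschetz_element_def total_degree_F
proof (intro conjI allI impI)
  show "cls V F (linear_form V a) \<in> graded_piece V F 1"
    unfolding graded_piece_def using linear_form_closed homogeneous_linear_form by blast
next
  fix k assume k: "2 * k \<le> s"
  define l where "l = linear_form V a ^ (s - 2 * k)"
  have l: "l \<in> carrier (poly_ring V)" "homogeneous (s - 2 * k) l"
    unfolding l_def
    by (intro poly_ring_power_closed linear_form_closed homogeneous_power homogeneous_linear_form)+
  let ?L = "lefschetz_map V F (cls V F (linear_form V a)) (s - 2 * k)"
  have L: "?L (cls V F f) = cls V F (l * f)" if "f \<in> carrier (poly_ring V)" for f
    using that unfolding l_def by (rule lefschetz_map_cls[OF linear_form_closed])
  have deg: "homogeneous (s - k) (l * f)" if "homogeneous k f" for f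
    using homogeneous_mult[OF l(2) that] k by (simp add: mult_2)
  show "bij_betw ?L (graded_piece V F k) (graded_piece V F (s - k))"
    unfolding bij_betw_def
  proof
    show "inj_on ?L (graded_piece V F k)"
      unfolding graded_piece_def
    proof (rule inj_onI; clarify)
      fix f g assume fg: "f \<in> carrier (poly_ring V)" "homogeneous k f"
        "g \<in> carrier (poly_ring V)" "homogeneous k g"
      assume "?L (cls V F f) = ?L (cls V F g)"
      then have "l * (f - g) \<in> Ann V F"
        using fg by (simp add: L cls_eq_iff right_diff_distrib)
      then show "cls V F f = cls V F g"
        using inj[OF k, of "f - g"] fg
        by (simp add: l_def cls_eq_iff poly_ring_diff_closed homogeneous_diff)
    qed
    have "y \<in> ?L ` graded_piece V F k" if y: "y \<in> graded_piece V F (s - k)" for y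
    proof -
      obtain h where h: "y = cls V F h" "h \<in> carrier (poly_ring V)" "homogeneous (s - k) h"
        using y unfolding graded_piece_def by auto
      define W where "W = {f \<in> carrier (poly_ring V). homogeneous k f}"
      define I where "I = {m :: nat \<Rightarrow>\<^sub>0 nat. keys m \<subseteq> V \<and> mon_degree m = k}"
      have I: "finite I" unfolding I_def by (rule finite_monomials_of_degree[OF finite_V])
      have "\<exists>c. \<forall>f\<in>W. pairing F (h * f) = (\<Sum>m\<in>I. c m * pairing F (monom m * (l * f)))"
      proof (rule functional_vanishing_on_common_kernel[where scale = "\<lambda>r f. Const r * f"])
        fix f assume f: "f \<in> W" "\<forall>m\<in>I. pairing F (monom m * (l * f)) = 0"
        have "l * f \<in> Ann V F"
          using f l deg k unfolding W_def I_def
          by (subst mem_Ann_homogeneous_iff[of _ "s - k"]) (auto intro: poly_ring_mult_closed)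
        then show "pairing F (h * f) = 0"
          using inj[OF k, of f] f unfolding l_def W_def by (auto intro: pairing_Ann)
      next
        fix f g r assume "f \<in> W" "g \<in> W"
        then show "f + Const r * g \<in> W"
          unfolding W_def
          by (auto intro: poly_ring_add_closed poly_ring_mult_closed poly_ring_Const_closed
              homogeneous_add homogeneous_Const_mult)
      next
        fix m f g r
        have "monom m * (l * (f + Const r * g)) = monom m * (l * f) + Const r * (monom m * (l * g))"
          by (simp add: algebra_simps)
        then show "pairing F (monom m * (l * (f + Const r * g)))
            = pairing F (monom m * (l * f)) + r * pairing F (monom m * (l * g))"
          by (simp add: pairing_add pairing_Const_mult)
      next
        fix f g r
        have "h * (f + Const r * g) = h * f + Const r * (h * g)" by (simp add: algebra_simps)
        then show "pairing F (h * (f + Const r * g)) = pairing F (h * f) + r * pairing F (h * g)"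
          by (simp add: pairing_add pairing_Const_mult)
      qed (fact I)
      then obtain c where c:
        "\<And>f. f \<in> W \<Longrightarrow> pairing F (h * f) = (\<Sum>m\<in>I. c m * pairing F (monom m * (l * f)))"
        by blast
      \<comment> \<open>The coefficients of the linear combination are those of the preimage.\<close>
      define g where "g = (\<Sum>m\<in>I. single m (c m))"
      have g: "g \<in> carrier (poly_ring V)" "homogeneous k g"
        unfolding g_def I_def
        by (auto intro!: poly_ring_sum_closed poly_ring_monom_closed homogeneous_sum
          homogeneous_single)
      have pairing_g: "pairing F (l * g * f) = pairing F (h * f)" if "f \<in> W" for f
      proof -
        have "l * g * f = (\<Sum>m\<in>I. Const (c m) * (monom m * (l * f)))"
          unfolding g_def
          by (simp add: sum_distrib_left sum_distrib_right Const_def mult_single algebra_simps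
              flip: mult.assoc)
        then show ?thesis by (simp add: c[OF that] pairing_sum pairing_Const_mult)
      qed
      have "l * g - h \<in> Ann V F"
      proof (subst mem_Ann_homogeneous_iff[of _ "s - k"]; (intro allI impI)?)
        show "l * g - h \<in> carrier (poly_ring V)" "homogeneous (s - k) (l * g - h)"
          using l g h deg by (auto intro: poly_ring_diff_closed poly_ring_mult_closed
            homogeneous_diff)
      next
        fix p assume "keys p \<subseteq> V \<and> mon_degree p + (s - k) = s"
        then have "monom p \<in> W"
          unfolding W_def using k by (auto intro: poly_ring_monom_closed homogeneous_single)
        then have "pairing F (l * g * monom p) = pairing F (h * monom p)" by (rule pairing_g)
        moreover have "monom p * (l * g - h) = l * g * monom p - h * monom p"
          by (simp add: algebra_simps)
        ultimately show "pairing F (monom p * (l * g - h)) = 0" by (simp add: pairing_diff)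
      qed
      then have "?L (cls V F g) = y" using L g h by (simp add: cls_eq_iff)
      then show ?thesis unfolding graded_piece_def using g by blast
    qed
    moreover have "?L ` graded_piece V F k \<subseteq> graded_piece V F (s - k)"
      unfolding graded_piece_def using L deg l by (auto intro!: imageI poly_ring_mult_closed)
    ultimately show "?L ` graded_piece V F k = graded_piece V F (s - k)" by blast
  qed
qed

lemma poincare_cls:
  assumes "homogeneous j f" "homogeneous k g" "j + k = s"
  shows "poincare F (cls V F f) (cls V F g) = pairing F (f * g)"
proof -
  have *: "diff_act (f' * g') F = Const (pairing F (f * g))"
    if "f' \<in> cls V F f" "g' \<in> cls V F g" for f' g'
  proof (rule dcoeff_inject[THEN iffD2], rule allI)
    fix p
    have "dcoeff (diff_act (f' * g') F) p = pairing F (monom p * (f * g))"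
      by (simp add: dcoeff_diff_act_eq_pairing pairing_cong_cls[OF that])
    also have "\<dots> = (if p = 0 then pairing F (f * g) else 0)"
    proof (cases "p = 0")
      case False
      have "homogeneous (mon_degree p + (j + k)) (monom p * (f * g))"
        by (intro homogeneous_monom_mult homogeneous_mult assms)
      then show ?thesis
        using False assms(3) mon_degree_eq_0_iff[of p] by (simp add: pairing_homogeneous_eq_0)
    qed simp
    also have "\<dots> = dcoeff (Const (pairing F (f * g))) p"
      by (simp add: dcoeff_def Const_def lookup_single when_def fact_weight_def)
    finally show "dcoeff (diff_act (f' * g') F) p = dcoeff (Const (pairing F (f * g))) p" .
  qed
  show ?thesis
    unfolding poincare_def
  proof (rule the_equality)
    fix r assume "\<forall>f\<in>cls V F f. \<forall>g\<in>cls V F g. diff_act (f * g) F = Const r"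
    then have "diff_act (f * g) F = Const r" using self_mem_cls by blast
    then have "Const r = Const (pairing F (f * g))" using *[OF self_mem_cls self_mem_cls] by simp
    then show "r = pairing F (f * g)" by (metis Const_def lookup_single_eq)
  qed (use * in blast)
qed

text \<open>
The relation expressed by representatives, which frees the rest of the development from cosets.
\<close>

lemma hodge_riemann_iff:
  "hodge_riemann_relation V F (cls V F (linear_form V a)) \<longleftrightarrow>
    (\<forall>k f. 2 * k \<le> s \<and> f \<in> carrier (poly_ring V) \<and> homogeneous k f \<and>
        linear_form V a ^ (s - 2 * k + 1) * f \<in> Ann V F \<and> f \<notin> Ann V F \<longrightarrow>
      0 < (- 1) ^ k * pairing F (f * (linear_form V a ^ (s - 2 * k) * f)))"
proof -
  define l where "l = linear_form V a"
  have l: "l \<in> carrier (poly_ring V)" unfolding l_def by (rule linear_form_closed)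
  have form: "hodge_riemann_form V F (cls V F l) k (cls V F f) (cls V F f)
      = (- 1) ^ k * pairing F (f * (l ^ (s - 2 * k) * f))"
    if "2 * k \<le> s" "f \<in> carrier (poly_ring V)" "homogeneous k f" for k f
  proof -
    have "homogeneous (s - 2 * k + k) (l ^ (s - 2 * k) * f)"
      unfolding l_def by (intro homogeneous_mult homogeneous_power homogeneous_linear_form that)
    then show ?thesis
      using that by (simp add: hodge_riemann_form_def total_degree_F lefschetz_map_cls[OF l]
          poincare_cls[of k f "s - 2 * k + k"])
  qed
  have prim: "x \<in> primitive_part V F (cls V F l) k \<longleftrightarrow>
      (\<exists>f. x = cls V F f \<and> f \<in> carrier (poly_ring V) \<and> homogeneous k f \<and>
        l ^ (s - 2 * k + 1) * f \<in> Ann V F)" for x k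
  proof -
    have "lefschetz_map V F (cls V F l) n (cls V F f) = \<zero>\<^bsub>Alg V F\<^esub> \<longleftrightarrow> l ^ n * f \<in> Ann V F"
      if "f \<in> carrier (poly_ring V)" for f n
      by (simp only: lefschetz_map_cls[OF l that] cls_eq_zero_iff)
    then show ?thesis
      unfolding primitive_part_def graded_piece_def total_degree_F by blast
  qed
  show ?thesis
    unfolding hodge_riemann_relation_def total_degree_F l_def[symmetric]
  proof (intro iffI allI impI ballI)
    fix k f
    assume *: "\<forall>k. 2 * k \<le> s \<longrightarrow> (\<forall>x\<in>primitive_part V F (cls V F l) k.
        x \<noteq> \<zero>\<^bsub>Alg V F\<^esub> \<longrightarrow> 0 < hodge_riemann_form V F (cls V F l) k x x)"
      and f: "2 * k \<le> s \<and> f \<in> carrier (poly_ring V) \<and> homogeneous k f \<and>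
        l ^ (s - 2 * k + 1) * f \<in> Ann V F \<and> f \<notin> Ann V F"
    then have "cls V F f \<in> primitive_part V F (cls V F l) k"
      "cls V F f \<noteq> \<zero>\<^bsub>Alg V F\<^esub>"
      unfolding prim cls_eq_zero_iff by blast+
    then show "0 < (- 1) ^ k * pairing F (f * (l ^ (s - 2 * k) * f))"
      using * f form[of k f] by metis
  next
    fix k x
    assume *: "\<forall>k f. 2 * k \<le> s \<and> f \<in> carrier (poly_ring V) \<and> homogeneous k f \<and>
        l ^ (s - 2 * k + 1) * f \<in> Ann V F \<and> f \<notin> Ann V F \<longrightarrow>
        0 < (- 1) ^ k * pairing F (f * (l ^ (s - 2 * k) * f))"
      and k: "2 * k \<le> s" and x: "x \<in> primitive_part V F (cls V F l) k" "x \<noteq> \<zero>\<^bsub>Alg V F\<^esub>"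
    obtain f where f: "x = cls V F f" "f \<in> carrier (poly_ring V)" "homogeneous k f"
        "l ^ (s - 2 * k + 1) * f \<in> Ann V F"
      using x(1) unfolding prim by blast
    moreover have "f \<notin> Ann V F" using x(2) unfolding f(1) cls_eq_zero_iff .
    ultimately show "0 < hodge_riemann_form V F (cls V F l) k x x"
      using * k form[of k f] by metis
  qed
qed

text \<open>
An element killed by \<open>\<ell>\<^bsup>s-2k\<^esup>\<close> is also killed by \<open>\<ell>\<^bsup>s-2k+1\<^esup>\<close>, hence primitive, and its form value is
zero; positive definiteness leaves only the zero element.
\<close>

lemma strong_lefschetz_of_hodge_riemann:
  assumes "hodge_riemann_relation V F (cls V F (linear_form V a))"
  shows "strong_lefschetz_element V F (cls V F (linear_form V a))"
proof (rule strong_lefschetz_of_injective, rule ccontr)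
  fix k f
  assume f: "2 * k \<le> s" "f \<in> carrier (poly_ring V)" "homogeneous k f"
    "linear_form V a ^ (s - 2 * k) * f \<in> Ann V F" "f \<notin> Ann V F"
  have "linear_form V a ^ (s - 2 * k + 1) * f \<in> Ann V F"
    using Ann_mult[OF f(4) linear_form_closed[of V a]] by (simp add: mult.assoc)
  then have "0 < (- 1) ^ k * pairing F (f * (linear_form V a ^ (s - 2 * k) * f))"
    using assms f unfolding hodge_riemann_iff by blast
  then show False using pairing_Ann[OF f(4), of f] by simp
qed

end

section \<open>Squarefree coefficients\<close>

text \<open>
The exponent vector of the squarefree monomial with variables \<open>S\<close>.
\<close>

definition sqf :: "nat set \<Rightarrow> nat \<Rightarrow>\<^sub>0 nat" where
  "sqf S = (\<Sum>v\<in>S. single v 1)"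

lemma lookup_sqf: "finite S \<Longrightarrow> lookup (sqf S) v = of_bool (v \<in> S)"
  by (simp add: sqf_def lookup_sum lookup_single when_def)

lemma keys_sqf: "finite S \<Longrightarrow> keys (sqf S) = S"
  by (auto simp: in_keys_iff lookup_sqf)

lemma sqf_inject: "finite S \<Longrightarrow> finite T \<Longrightarrow> sqf S = sqf T \<longleftrightarrow> S = T"
  by (metis keys_sqf)

lemma mon_degree_sqf: "finite S \<Longrightarrow> mon_degree (sqf S) = card S"
  by (simp add: mon_degree_def keys_sqf lookup_sqf)

lemma fact_weight_sqf: "finite S \<Longrightarrow> fact_weight (sqf S) = 1"
  by (simp add: fact_weight_def keys_sqf lookup_sqf)

lemma prod_Var: "finite S \<Longrightarrow> (\<Prod>v\<in>S. Var v) = monom (sqf S)"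
  by (induction S rule: finite_induct) (simp_all add: sqf_def Var_def mult_single)

lemma Var_eq: "Var v = monom (sqf {v})"
  by (simp add: Var_def sqf_def)

lemma lookup_monom_mult:
  "lookup (monom p * g) q = (\<Sum>m\<in>keys g. if p + m = q then lookup g m else 0)"
proof -
  have "monom p * g = (\<Sum>m\<in>keys g. single (p + m) (lookup g m))"
    by (subst (1) poly_as_sum_of_terms[of g]) (simp add: sum_distrib_left mult_single)
  then show ?thesis by (simp add: lookup_sum lookup_single when_def)
qed

text \<open>
A divisor of a squarefree monomial is squarefree.
\<close>

lemma lookup_monom_mult_sqf:
  assumes "finite T"
  shows "lookup (monom p * g) (sqf T)
    = (if p = sqf (keys p) \<and> keys p \<subseteq> T then lookup g (sqf (T - keys p)) else 0)"
proof (cases "p = sqf (keys p) \<and> keys p \<subseteq> T")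
  case True
  have "p + m = sqf T \<longleftrightarrow> m = sqf (T - keys p)" for m
  proof -
    have "sqf T = sqf (T - keys p) + sqf (keys p)"
      unfolding sqf_def using True assms by (intro sum.subset_diff) auto
    then have "p + sqf (T - keys p) = sqf T"
      using True by (metis add.commute)
    then show ?thesis by (metis add_left_cancel)
  qed
  then show ?thesis using True by (simp add: lookup_monom_mult in_keys_iff)
next
  case False
  have "p + m \<noteq> sqf T" for m
  proof
    assume eq: "p + m = sqf T"
    have le: "lookup p v \<le> of_bool (v \<in> T)" for v
      using arg_cong[OF eq, of "\<lambda>q. lookup q v"] assms by (simp add: lookup_add lookup_sqf)
    then have "keys p \<subseteq> T" by (metis bot_nat_0.extremum_uniqueI in_keys_iff
      of_bool_eq(1) subsetI)
    moreover have "lookup p v = lookup (sqf (keys p)) v" for v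
      using le[of v] by (cases "v \<in> T") (auto simp: lookup_sqf in_keys_iff)
    then have "p = sqf (keys p)" by (rule poly_mapping_eqI)
    ultimately show False using False by blast
  qed
  then show ?thesis unfolding lookup_monom_mult using False by (simp add: if_not_P cong: if_cong)
qed

lemma lookup_linear_form_mult:
  assumes "finite V" "T \<subseteq> V"
  shows "lookup (linear_form V a * g) (sqf T) = (\<Sum>v\<in>T. a v * lookup g (sqf (T - {v})))"
proof -
  have T: "finite T" using assms finite_subset by blast
  have "linear_form V a * g = (\<Sum>v\<in>V. Const (a v) * (Var v * g))"
    by (simp add: linear_form_def sum_distrib_right mult.assoc)
  then have "lookup (linear_form V a * g) (sqf T)
      = (\<Sum>v\<in>V. if v \<in> T then a v * lookup g (sqf (T - {v})) else 0)"
    by (simp add: lookup_sum Const_mult_eq Var_eq lookup_monom_mult_sqf[OF T] keys_sqf)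
       (intro sum.cong, auto simp: keys_sqf)
  also have "\<dots> = (\<Sum>v\<in>T. a v * lookup g (sqf (T - {v})))"
    using assms by (simp add: sum.inter_restrict[symmetric] Int_absorb1)
  finally show ?thesis .
qed

text \<open>
Expanding the power picks the elements of \<open>T - P\<close> one after the other; the \<open>j!\<close> orders of picking
them all contribute the same product.
\<close>

lemma lookup_linear_form_power_mult:
  assumes V: "finite V" and "T \<subseteq> V"
  shows "lookup (linear_form V a ^ j * f) (sqf T)
    = fact j * (\<Sum>P | P \<subseteq> T \<and> card P + j = card T. lookup f (sqf P) * (\<Prod>v\<in>T - P. a v))"
  using assms(2)
proof (induction j arbitrary: T)
  case 0
  then have "finite T" using V finite_subset by blast
  then have "{P. P \<subseteq> T \<and> card P = card T} = {T}"
    by (auto dest: card_subset_eq)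
  then show ?case by simp
next
  case (Suc j)
  have T: "finite T" using Suc.prems V finite_subset by blast
  let ?c = "\<lambda>P. lookup f (sqf P)"
  let ?I = "{P. P \<subseteq> T \<and> card P + Suc j = card T}"
  have I: "finite ?I" using T by simp
  have "lookup (linear_form V a ^ Suc j * f) (sqf T)
      = (\<Sum>v\<in>T. a v * lookup (linear_form V a ^ j * f) (sqf (T - {v})))"
    unfolding power_Suc mult.assoc by (rule lookup_linear_form_mult[OF V Suc.prems])
  also have "\<dots> = (\<Sum>v\<in>T. \<Sum>P\<in>{P \<in> ?I. v \<notin> P}. fact j * ?c P * (\<Prod>u\<in>T - P. a u))"
  proof (intro sum.cong refl)
    fix v assume v: "v \<in> T"
    have "card T = Suc (card (T - {v}))" using v T by (rule card.remove[rotated])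
    then have "{P. P \<subseteq> T - {v} \<and> card P + j = card (T - {v})} = {P \<in> ?I. v \<notin> P}"
      by auto
    then have IH: "lookup (linear_form V a ^ j * f) (sqf (T - {v}))
        = fact j * (\<Sum>P\<in>{P \<in> ?I. v \<notin> P}. ?c P * (\<Prod>u\<in>T - {v} - P. a u))"
      using Suc.IH[of "T - {v}"] Suc.prems by auto
    have prod_eq: "(\<Prod>u\<in>T - P. a u) = a v * (\<Prod>u\<in>T - {v} - P. a u)" if "v \<notin> P" for P
    proof -
      have "T - {v} - P = (T - P) - {v}" by blast
      then show ?thesis using prod.remove[of "T - P" v a] v that T by simp
    qed
    have "a v * lookup (linear_form V a ^ j * f) (sqf (T - {v}))
        = (\<Sum>P\<in>{P \<in> ?I. v \<notin> P}. fact j * ?c P * (a v * (\<Prod>u\<in>T - {v} - P. a u)))"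
      by (simp add: IH sum_distrib_left mult.left_commute mult.assoc)
    then show "a v * lookup (linear_form V a ^ j * f) (sqf (T - {v}))
        = (\<Sum>P\<in>{P \<in> ?I. v \<notin> P}. fact j * ?c P * (\<Prod>u\<in>T - P. a u))"
      by (simp add: prod_eq)
  qed
  also have "\<dots> = (\<Sum>P\<in>?I. \<Sum>v\<in>{v \<in> T. v \<notin> P}. fact j * ?c P * (\<Prod>u\<in>T - P. a u))"
    by (rule sum.swap_restrict[OF T I])
  also have "\<dots> = (\<Sum>P\<in>?I. fact (Suc j) * (?c P * (\<Prod>u\<in>T - P. a u)))"
  proof (intro sum.cong refl)
    fix P assume P: "P \<in> ?I"
    then have "card (T - P) = Suc j"
      using T finite_subset[of P T] by (subst card_Diff_subset) auto
    then have "card {v \<in> T. v \<notin> P} = Suc j" by (simp add: set_diff_eq)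
    then show "(\<Sum>v\<in>{v \<in> T. v \<notin> P}. fact j * ?c P * (\<Prod>u\<in>T - P. a u))
        = fact (Suc j) * (?c P * (\<Prod>u\<in>T - P. a u))"
      by (simp add: algebra_simps)
  qed
  finally show ?case by (simp add: sum_distrib_left)
qed

lemma lookup_linear_form: "finite V \<Longrightarrow> v \<in> V \<Longrightarrow> lookup (linear_form V a) (sqf {v}) = a v"
  using lookup_linear_form_mult[of V "{v}" a 1] by (simp add: sqf_def)

definition facet_poly :: "nat set set \<Rightarrow> rpoly" where
  "facet_poly \<F> = (\<Sum>S\<in>\<F>. \<Prod>v\<in>S. Var v)"

definition face_weight :: "(nat \<Rightarrow> real) \<Rightarrow> nat set \<Rightarrow> real" where
  "face_weight a S = (\<Prod>v\<in>S. a v)"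

section \<open>Face polynomials of pure complexes\<close>

text \<open>
A pure complex on \<open>V\<close>, given by its facets; for a solid these are the faces, and the faces of the
complex are their subsets.
\<close>

locale facets =
  fixes V :: "nat set" and \<F> :: "nat set set" and s :: nat
  assumes finite_vertices: "finite V"
    and facets_nonempty: "\<F> \<noteq> {}"
    and facet_subset: "S \<in> \<F> \<Longrightarrow> S \<subseteq> V"
    and card_facet: "S \<in> \<F> \<Longrightarrow> card S = s"
begin

lemma finite_facet: "S \<in> \<F> \<Longrightarrow> finite S"
  using facet_subset finite_vertices finite_subset by blast

lemma finite_facets: "finite \<F>"
  using finite_vertices facet_subset by (intro finite_subset[of \<F> "Pow V"]) auto

lemma facet_poly_eq: "(facet_poly \<F>) = (\<Sum>S\<in>\<F>. monom (sqf S))"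
  unfolding facet_poly_def by (intro sum.cong) (auto simp: prod_Var finite_facet)

lemma pairing_facet_poly: "pairing (facet_poly \<F>) f = (\<Sum>S\<in>\<F>. lookup f (sqf S))"
proof -
  have "dcoeff (facet_poly \<F>) m = (\<Sum>S\<in>\<F>. of_bool (m = sqf S))" for m
    unfolding facet_poly_eq dcoeff_sum
    by (intro sum.cong) (auto simp: dcoeff_def lookup_single when_def fact_weight_sqf finite_facet)
  then have "pairing (facet_poly \<F>) f = (\<Sum>m\<in>keys f. \<Sum>S\<in>\<F>. lookup f m * of_bool (m = sqf S))"
    by (simp add: pairing_def sum_distrib_left)
  also have "\<dots> = (\<Sum>S\<in>\<F>. \<Sum>m\<in>keys f. lookup f m * of_bool (m = sqf S))"
    by (rule sum.swap)
  also have "\<dots> = (\<Sum>S\<in>\<F>. lookup f (sqf S))"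
    by (intro sum.cong) (auto simp: of_bool_def in_keys_iff if_distrib cong: if_cong)
  finally show ?thesis .
qed

sublocale dual_generator V "facet_poly \<F>" s
proof
  show "finite V" by (rule finite_vertices)
  show "(facet_poly \<F>) \<in> carrier (poly_ring V)"
    unfolding facet_poly_eq using finite_facet facet_subset
    by (intro poly_ring_sum_closed poly_ring_monom_closed) (auto simp: keys_sqf)
  show "homogeneous s (facet_poly \<F>)"
    unfolding facet_poly_def using homogeneous_prod_Var finite_facet card_facet
    by (intro homogeneous_sum) blast
  obtain T where T: "T \<in> \<F>" using facets_nonempty by blast
  have "lookup (facet_poly \<F>) (sqf T) = (\<Sum>S\<in>\<F>. of_bool (S = T))"
    unfolding facet_poly_eq lookup_sum
    by (intro sum.cong) (auto simp: lookup_single when_def sqf_inject T finite_facet)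
  also have "\<dots> = 1" using T finite_facets by (simp add: of_bool_def)
  finally show "(facet_poly \<F>) \<noteq> 0" by auto
qed

text \<open>
Only squarefree test monomials \<open>x\<^sup>Q\<close> divide a monomial of the face polynomial.
\<close>

lemma mem_Ann_facet_iff:
  assumes "f \<in> carrier (poly_ring V)" "homogeneous k f"
  shows "f \<in> Ann V (facet_poly \<F>) \<longleftrightarrow>
    (\<forall>Q. Q \<subseteq> V \<and> card Q + k = s \<longrightarrow> (\<Sum>S\<in>\<F>. if Q \<subseteq> S then lookup f (sqf (S - Q)) else 0) = 0)"
proof -
  have eq: "pairing (facet_poly \<F>) (monom p * f)
      = (if p = sqf (keys p) then \<Sum>S\<in>\<F>. if keys p \<subseteq> S then lookup f (sqf (S - keys p)) else 0
         else 0)" for p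
    by (simp add: pairing_facet_poly lookup_monom_mult_sqf finite_facet cong: sum.cong)
  show ?thesis
    unfolding mem_Ann_homogeneous_iff[OF assms]
  proof (intro iffI allI impI)
    fix Q assume *: "\<forall>p. keys p \<subseteq> V \<and> mon_degree p
      + k = s \<longrightarrow> pairing (facet_poly \<F>) (monom p * f) = 0"
      and Q: "Q \<subseteq> V \<and> card Q + k = s"
    have "finite Q" using Q finite_vertices finite_subset by blast
    then show "(\<Sum>S\<in>\<F>. if Q \<subseteq> S then lookup f (sqf (S - Q)) else 0) = 0"
      using * Q eq[of "sqf Q"] by (simp add: keys_sqf mon_degree_sqf cong: if_cong)
  next
    fix p :: "nat \<Rightarrow>\<^sub>0 nat"
    assume *: "\<forall>Q. Q \<subseteq> V \<and> card Q + k = s \<longrightarrow>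
        (\<Sum>S\<in>\<F>. if Q \<subseteq> S then lookup f (sqf (S - Q)) else 0) = 0"
      and p: "keys p \<subseteq> V \<and> mon_degree p + k = s"
    show "pairing (facet_poly \<F>) (monom p * f) = 0"
      using * p mon_degree_sqf[of "keys p"] unfolding eq by (metis finite_keys)
  qed
qed

text \<open>
The value \<open>\<ell>\<^sup>s F = s! F(a)\<close>, which is the Hodge--Riemann form on \<open>A\<^sub>0\<close>.
\<close>

lemma pairing_linear_form_power:
  "pairing (facet_poly \<F>) (linear_form V a ^ s) = fact s * (\<Sum>S\<in>\<F>. face_weight a S)"
proof -
  have "lookup (linear_form V a ^ s) (sqf S) = fact s * face_weight a S" if S: "S \<in> \<F>" for S
  proof -
    have "{P. P \<subseteq> S \<and> card P + s = card S} = {{}}"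
      using card_facet[OF S] finite_facet[OF S] by (auto dest: finite_subset)
    moreover have "lookup (1 :: rpoly) (sqf {}) = 1" by (simp add: sqf_def)
    ultimately show ?thesis
      using lookup_linear_form_power_mult[OF finite_vertices facet_subset[OF S], of a s 1]
      by (simp add: face_weight_def)
  qed
  then show ?thesis by (simp add: pairing_facet_poly sum_distrib_left)
qed

text \<open>
The equations \<open>L(x\<^sup>Q \<ell>\<^bsup>s-2k\<^esup> f) = 0\<close> for all \<open>Q\<close> with \<open>k\<close> elements, up to the factor \<open>(s-2k)!\<close>, in
the rescaled coefficients \<open>z\<^sub>P\<close> of \<open>f\<close>.
\<close>

definition weight_system :: "(nat \<Rightarrow> real) \<Rightarrow> nat \<Rightarrow> (nat set \<Rightarrow> real) \<Rightarrow> bool" where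
  "weight_system a k z \<longleftrightarrow> (\<forall>Q. Q \<subseteq> V \<and> card Q = k \<longrightarrow>
    (\<Sum>S\<in>\<F>. if Q \<subseteq> S then face_weight a S * (\<Sum>P | P \<subseteq> S - Q \<and> card P = k. z P) else 0) = 0)"

text \<open>
For a face \<open>S\<close> containing the disjoint sets \<open>P\<close> and \<open>Q\<close>, the product of \<open>a\<close> over \<open>S - Q - P\<close> times the
products over \<open>P\<close> and \<open>Q\<close> is the face weight of \<open>S\<close>. So rescaling the unknowns and the equations leaves
only face weights. In the middle degree \<open>2k = s\<close> the Lefschetz map is the identity.
\<close>

lemma strong_lefschetz_of_weights:
  assumes nonzero: "\<And>v. v \<in> V \<Longrightarrow> a v \<noteq> 0"
    and trivial: "\<And>k z S P. 2 * k < s \<Longrightarrow> weight_system a k z \<Longrightarrow> S \<in> \<F> \<Longrightarrow> P \<subseteq> S \<Longrightarrow> card P = k \<Longrightarrow> z P = 0"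
  shows "strong_lefschetz_element V (facet_poly \<F>) (cls V (facet_poly \<F>) (linear_form V a))"
proof (rule strong_lefschetz_of_injective)
  fix k f
  assume k: "2 * k \<le> s" and f: "f \<in> carrier (poly_ring V)" "homogeneous k f"
    and Ann: "linear_form V a ^ (s - 2 * k) * f \<in> Ann V (facet_poly \<F>)"
  show "f \<in> Ann V (facet_poly \<F>)"
  proof (cases "2 * k = s")
    case True
    then show ?thesis using Ann by simp
  next
    case False
    then have k': "2 * k < s" using k by simp
    let ?l = "linear_form V a ^ (s - 2 * k)"
    define z where "z P = lookup f (sqf P) / face_weight a P" for P
    have w_nz: "face_weight a P \<noteq> 0" if "P \<subseteq> V" for P
      using that nonzero finite_vertices finite_subset[of P V] by (auto simp: face_weight_def)
    have lf: "?l * f \<in> carrier (poly_ring V)" "homogeneous (s - 2 * k + k) (?l * f)"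
      using f by (auto intro!: poly_ring_mult_closed poly_ring_power_closed linear_form_closed
          homogeneous_mult homogeneous_power homogeneous_linear_form)
    have coeff: "face_weight a Q * lookup (?l * f) (sqf (S - Q))
        = fact (s - 2 * k) * (face_weight a S * (\<Sum>P | P \<subseteq> S - Q \<and> card P = k. z P))"
      if S: "S \<in> \<F>" and Q: "Q \<subseteq> S" "card Q = k" for S Q
    proof -
      have fin: "finite S" "finite Q" using S Q finite_facet finite_subset by blast+
      have "card (S - Q) = s - k" using fin Q card_facet[OF S] by (simp add: card_Diff_subset)
      then have I: "{P. P \<subseteq> S - Q \<and> card P + (s - 2 * k) = card (S - Q)}
          = {P. P \<subseteq> S - Q \<and> card P = k}"
        using k by auto
      have "face_weight a Q * (lookup f (sqf P) * (\<Prod>v\<in>S - Q - P. a v)) = face_weight a S * z P"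
        if P: "P \<subseteq> S - Q" for P
      proof -
        have "face_weight a S = face_weight a Q * face_weight a (S - Q)"
          unfolding face_weight_def using prod.subset_diff[OF Q(1) fin(1)] by (simp add:
            mult.commute)
        also have "face_weight a (S - Q) = face_weight a P * (\<Prod>v\<in>S - Q - P. a v)"
          unfolding face_weight_def using prod.subset_diff[OF P] fin by (simp add: mult.commute)
        finally show ?thesis
          using w_nz[of P] P facet_subset[OF S] unfolding z_def by (auto simp: field_simps)
      qed
      then have "face_weight a Q *
            (\<Sum>P | P \<subseteq> S - Q \<and> card P = k. lookup f (sqf P) * (\<Prod>v\<in>S - Q - P. a v))
          = face_weight a S * (\<Sum>P | P \<subseteq> S - Q \<and> card P = k. z P)"
        unfolding sum_distrib_left by (intro sum.cong) auto
      moreover have "S - Q \<subseteq> V" using facet_subset[OF S] by blast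
      ultimately show ?thesis
        using lookup_linear_form_power_mult[OF finite_vertices, of "S - Q" a "s - 2 * k" f]
        unfolding I by (simp add: mult.left_commute)
    qed
    have sys: "weight_system a k z"
      unfolding weight_system_def
    proof (intro allI impI, elim conjE)
      fix Q assume Q: "Q \<subseteq> V" "card Q = k"
      have "0 = face_weight a Q * (\<Sum>S\<in>\<F>. if Q \<subseteq> S then lookup (?l * f) (sqf (S - Q)) else 0)"
        using Ann Q k unfolding mem_Ann_facet_iff[OF lf] by simp
      also have "\<dots> = fact (s - 2 * k) *
          (\<Sum>S\<in>\<F>. if Q \<subseteq> S then face_weight a S * (\<Sum>P | P \<subseteq> S - Q \<and> card P = k. z P) else 0)"
        unfolding sum_distrib_left by (intro sum.cong) (auto simp: coeff Q(2) sum_distrib_left)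
      finally show "(\<Sum>S\<in>\<F>. if Q \<subseteq> S
          then face_weight a S * (\<Sum>P | P \<subseteq> S - Q \<and> card P = k. z P) else 0) =
            0" by simp
    qed
    have "lookup f (sqf P) = 0" if "S \<in> \<F>" "P \<subseteq> S" "card P = k" for S P
      using trivial[OF k' sys that] w_nz[of P] that facet_subset[of S] unfolding z_def by auto
    then show ?thesis
      unfolding mem_Ann_facet_iff[OF f]
      by (auto intro!: sum.neutral simp: card_facet card_Diff_subset finite_subset[OF _
        finite_facet])
  qed
qed

lemma weight_system_0:
  assumes "weight_system a 0 z"
  shows "(\<Sum>S\<in>\<F>. face_weight a S) * z {} = 0"
proof -
  have "(\<Sum>S\<in>\<F>. face_weight a S * (\<Sum>P | P \<subseteq> S \<and> card P = 0. z P)) = 0"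
    using assms[unfolded weight_system_def, rule_format, of "{}"] by simp
  moreover have "{P. P \<subseteq> S \<and> card P = 0} = {{}}" if "S \<in> \<F>" for S
    using finite_facet[OF that] by (auto dest: finite_subset)
  ultimately show ?thesis by (simp add: sum_distrib_right)
qed

lemma weight_system_1:
  assumes "weight_system a 1 z" "u \<in> V"
  shows "(\<Sum>S\<in>\<F>. if u \<in> S then face_weight a S * (\<Sum>v\<in>S - {u}. z {v}) else 0) = 0"
proof -
  have "{P. P \<subseteq> S - {u} \<and> card P = 1} = (\<lambda>v. {v}) ` (S - {u})" for S
    by (auto simp: card_1_singleton_iff)
  then have "(\<Sum>P | P \<subseteq> S - {u} \<and> card P = 1. z P) = (\<Sum>v\<in>S - {u}. z {v})" for S
    by (simp add: sum.reindex)
  then show ?thesis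
    using assms(1)[unfolded weight_system_def, rule_format, of "{u}"] assms(2)
    by (simp del: One_nat_def cong: if_cong)
qed

lemma strong_lefschetz_of_vertex_system:
  assumes "s \<le> 4" and nonzero: "\<And>v. v \<in> V \<Longrightarrow> a v \<noteq> 0"
    and total: "(\<Sum>S\<in>\<F>. face_weight a S) \<noteq> 0"
    and trivial: "\<And>(z :: nat \<Rightarrow> real) v.
      (\<And>u. u \<in> V \<Longrightarrow> (\<Sum>S\<in>\<F>. if u \<in> S then face_weight a S * (\<Sum>v\<in>S - {u}. z v) else 0) = 0) \<Longrightarrow>
      v \<in> V \<Longrightarrow> z v = 0"
  shows "strong_lefschetz_element V (facet_poly \<F>) (cls V (facet_poly \<F>) (linear_form V a))"
proof (rule strong_lefschetz_of_weights[OF nonzero])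
  fix k z S P
  assume k: "2 * k < s" and sys: "weight_system a k z"
    and P: "S \<in> \<F>" "P \<subseteq> S" "card P = k"
  consider "k = 0" | "k = 1" using k assms(1) by linarith
  then show "z P = 0"
  proof cases
    case 1
    then have "P = {}" using P finite_subset[OF _ finite_facet] by auto
    then show ?thesis using weight_system_0[of a z] sys 1 total by simp
  next
    case 2
    then obtain v where "P = {v}" using P by (auto simp: card_1_singleton_iff)
    then show ?thesis
      using trivial[of "\<lambda>v. z {v}" v] weight_system_1[of a z] sys 2 P facet_subset[OF
        P(1)] by auto
  qed
qed

text \<open>
For \<open>k = 0\<close> every element is primitive, and the form takes the value \<open>s! F(a)\<close> at \<open>1\<close>.
\<close>

lemma not_hodge_riemann_of_negative:
  assumes "(\<Sum>S\<in>\<F>. face_weight a S) < 0"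
  shows "\<not> hodge_riemann_relation V (facet_poly \<F>) (cls V (facet_poly \<F>) (linear_form V a))"
proof
  assume HR: "hodge_riemann_relation V (facet_poly \<F>) (cls V (facet_poly \<F>) (linear_form V a))"
  have neg: "pairing (facet_poly \<F>) (linear_form V a ^ s) < 0"
    using assms by (simp add: pairing_linear_form_power mult_pos_neg)
  then have "1 \<notin> Ann V (facet_poly \<F>)"
    using pairing_Ann[of 1 V "facet_poly \<F>" "linear_form V a ^ s"] by auto
  moreover have "linear_form V a ^ (s + 1) * 1 \<in> Ann V (facet_poly \<F>)"
    using homogeneous_power[OF homogeneous_linear_form[of V a], of "s + 1"]
    by (subst mem_Ann_homogeneous_iff[of _ "s + 1"])
       (auto intro!: poly_ring_mult_closed poly_ring_power_closed linear_form_closed)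
  ultimately have "0 < pairing (facet_poly \<F>) (linear_form V a ^ s)"
    using HR[unfolded hodge_riemann_iff, rule_format, of 0 1]
    by (simp add: poly_ring_one_closed homogeneous_one)
  then show False using neg by simp
qed

text \<open>
The inner sum is the derivative of the face polynomial at \<open>a\<close> in direction \<open>c\<close>.
\<close>

lemma pairing_linear_form_power_mult:
  assumes "s = Suc j"
  shows "pairing (facet_poly \<F>) (linear_form V a ^ j * linear_form V c)
    = fact j * (\<Sum>S\<in>\<F>. \<Sum>v\<in>S. c v * face_weight a (S - {v}))"
proof -
  have "lookup (linear_form V a ^ j * linear_form V c) (sqf S)
      = fact j * (\<Sum>v\<in>S. c v * face_weight a (S - {v}))" if S: "S \<in> \<F>" for S
  proof -
    have fin: "finite S" by (rule finite_facet[OF S])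
    have lf: "lookup (linear_form V c) (sqf {v}) = c v" if "v \<in> S" for v
      using lookup_linear_form[OF finite_vertices] facet_subset[OF S] that by blast
    have "{P. P \<subseteq> S \<and> card P + j = card S} = (\<lambda>v. {v}) ` S"
      using assms card_facet[OF S] by (auto simp: card_1_singleton_iff)
    then have "lookup (linear_form V a ^ j * linear_form V c) (sqf S)
        = fact j * (\<Sum>P\<in>(\<lambda>v. {v}) ` S. lookup (linear_form V c) (sqf P) * face_weight a (S - P))"
      using lookup_linear_form_power_mult[OF finite_vertices facet_subset[OF S]]
      by (simp add: face_weight_def)
    also have "\<dots> = fact j * (\<Sum>v\<in>S. c v * face_weight a (S - {v}))"
      by (subst sum.reindex) (auto simp: lf)
    finally show ?thesis .
  qed
  then show ?thesis by (simp add: pairing_facet_poly sum_distrib_left)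
qed

lemma homogeneous_0_eq_Const: "homogeneous 0 f \<Longrightarrow> f = Const (lookup f 0)"
  by (rule poly_mapping_eqI)
     (metis Const_def homogeneous_iff lookup_single_eq lookup_single_not_eq mon_degree_eq_0_iff)

lemma homogeneous_1_eq_linear_form:
  assumes "f \<in> carrier (poly_ring V)" "homogeneous 1 f"
  shows "f = linear_form V (\<lambda>v. lookup f (single v 1))"
proof (rule poly_mapping_eqI)
  fix m
  have lf: "lookup (linear_form V (\<lambda>v. lookup f (single v 1))) m
      = (\<Sum>v\<in>V. if m = single v 1 then lookup f m else 0)"
    unfolding linear_form_def lookup_sum Const_mult_eq Var_def
    by (intro sum.cong) (auto simp: lookup_single when_def)
  show "lookup f m = lookup (linear_form V (\<lambda>v. lookup f (single v 1))) m"
  proof (cases "lookup f m = 0")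
    case True
    then have "(\<Sum>v\<in>V. if m = single v 1 then lookup f m else 0) = 0"
      by (intro sum.neutral) auto
    with True show ?thesis unfolding lf by simp
  next
    case False
    then have m: "keys m \<subseteq> V" "mon_degree m = 1"
      using assms unfolding mem_poly_ring_iff homogeneous_iff by blast+
    obtain v where v: "v \<in> keys m"
      using m(2) mon_degree_eq_0_iff[of m] by (metis all_not_in_conv keys_eq_empty zero_neq_one)
    have "m = single v 1 + (m - single v 1)"
      using v by (intro poly_mapping_eqI) (auto simp: lookup_add lookup_minus lookup_single
        when_def in_keys_iff)
    moreover from this have "m - single v 1 = 0"
      using m(2) mon_degree_add[of "single v 1" "m - single v 1"] mon_degree_eq_0_iff by auto
    ultimately have m_eq: "m = single v 1" by simp
    have "(m = single u 1) = (u = v)" for u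
      unfolding m_eq by (metis keys_single one_neq_zero singleton_inject)
    then show ?thesis unfolding lf using v m finite_vertices by auto
  qed
qed

text \<open>
For \<open>k = 1\<close> and \<open>f = \<ell>\<^sub>c\<close>, both the condition \<open>\<ell>\<^sub>a\<^sup>2 \<ell>\<^sub>c = 0\<close> and the form value \<open>- \<ell>\<^sub>a \<ell>\<^sub>c\<^sup>2\<close> are directional
derivatives of the face polynomial, with \<open>a\<close> and \<open>c\<close> exchanged.
\<close>

lemma hodge_riemann_cubic:
  assumes s: "s = 3"
    and pos: "(\<Sum>S\<in>\<F>. face_weight a S) > 0"
    and neg: "\<And>c. (\<Sum>S\<in>\<F>. \<Sum>v\<in>S. c v * face_weight a (S - {v})) = 0 \<Longrightarrow>
      linear_form V c \<notin> Ann V (facet_poly \<F>) \<Longrightarrow>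
      (\<Sum>S\<in>\<F>. \<Sum>v\<in>S. a v * face_weight c (S - {v})) < 0"
  shows "hodge_riemann_relation V (facet_poly \<F>) (cls V (facet_poly \<F>) (linear_form V a))"
  unfolding hodge_riemann_iff
proof (intro allI impI, elim conjE)
  fix k f
  let ?l = "linear_form V a"
  assume k: "2 * k \<le> s" and f: "f \<in> carrier (poly_ring V)" "homogeneous k f"
    and prim: "?l ^ (s - 2 * k + 1) * f \<in> Ann V (facet_poly \<F>)" and nz: "f \<notin> Ann V (facet_poly \<F>)"
  consider "k = 0" | "k = 1" using k s by linarith
  then show "0 < (- 1) ^ k * pairing (facet_poly \<F>) (f * (?l ^ (s - 2 * k) * f))"
  proof cases
    case 1
    obtain r where r: "f = Const r" using homogeneous_0_eq_Const f(2) 1 by blast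
    then have "r \<noteq> 0" using nz Ann_zero by (auto simp: Const_def)
    have "f * (?l ^ s * f) = Const r * (Const r * ?l ^ s)" using r by (simp add: mult_ac)
    then have "pairing (facet_poly \<F>) (f * (?l ^ s * f)) = r * (r * (fact s * (\<Sum>S\<in>\<F>. face_weight a S)))"
      by (simp only: pairing_Const_mult pairing_linear_form_power)
    moreover have "0 < r * r * (fact s * (\<Sum>S\<in>\<F>. face_weight a S))"
      using pos \<open>r \<noteq> 0\<close> by (auto simp: zero_less_mult_iff)
    ultimately show ?thesis using 1 by (simp add: mult.assoc)
  next
    case 2
    obtain c where c: "f = linear_form V c" using homogeneous_1_eq_linear_form f 2 by blast
    have "?l ^ 2 * f \<in> Ann V (facet_poly \<F>)" using prim s 2 by (simp add: power2_eq_square)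
    from pairing_Ann[OF this, of 1]
    have "(\<Sum>S\<in>\<F>. \<Sum>v\<in>S. c v * face_weight a (S - {v})) = 0"
      using pairing_linear_form_power_mult[of 2 a c] s c by simp
    then have "(\<Sum>S\<in>\<F>. \<Sum>v\<in>S. a v * face_weight c (S - {v})) < 0"
      using neg nz c by blast
    then have "pairing (facet_poly \<F>) (linear_form V c ^ 2 * ?l) < 0"
      using pairing_linear_form_power_mult[of 2 c a] s by simp
    moreover have "linear_form V c ^ 2 * ?l = f * (?l * f)"
      by (simp add: c power2_eq_square mult_ac)
    ultimately have "pairing (facet_poly \<F>) (f * (?l * f)) < 0" by (simp only:)
    then show ?thesis using s 2 by simp
  qed
qed

end

section \<open>Symmetries of the fact_weight system\<close>

context facets begin

text \<open>
Being an involution is what allows a solution to be split into an even and an odd part.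
\<close>

definition face_symmetry :: "(nat \<Rightarrow> real) \<Rightarrow> (nat \<Rightarrow> nat) \<Rightarrow> bool" where
  "face_symmetry a r \<longleftrightarrow> (\<forall>v. r (r v) = v) \<and> r ` V \<subseteq> V \<and> (\<forall>S\<in>\<F>. r ` S \<in> \<F>) \<and>
    (\<forall>v\<in>V. a (r v) = a v)"

lemma weight_system_symmetry:
  assumes r: "face_symmetry a r" and sys: "weight_system a k z"
  shows "weight_system a k (\<lambda>P. z (r ` P))"
  unfolding weight_system_def
proof (intro allI impI, elim conjE)
  fix Q assume Q: "Q \<subseteq> V" "card Q = k"
  have rr: "r (r v) = v" for v using r by (simp add: face_symmetry_def)
  have rr_image: "r ` r ` S = S" for S by (simp add: image_image rr)
  have inj: "inj r" by (metis injI rr)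
  define G where "G z Q S = (if Q \<subseteq> S then face_weight a S *
      (\<Sum>P | P \<subseteq> S - Q \<and> card P = k. z P) else 0)" for z :: "nat set \<Rightarrow> real" and Q S
  have "G (\<lambda>P. z (r ` P)) Q S = G z (r ` Q) (r ` S)" if S: "S \<in> \<F>" for S
  proof -
    have "face_weight a (r ` S) = face_weight a S"
      unfolding face_weight_def using inj r facet_subset[OF S]
      by (subst prod.reindex) (auto simp: face_symmetry_def inj_on_subset intro!: prod.cong)
    moreover have "(\<Sum>P | P \<subseteq> S - Q \<and> card P = k. z (r ` P))
        = (\<Sum>P | P \<subseteq> r ` S - r ` Q \<and> card P = k. z P)"
    proof (rule sum.reindex_bij_witness[of _ "image r" "image r"])
      fix P assume "P \<in> {P. P \<subseteq> S - Q \<and> card P = k}"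
      then show "r ` P \<in> {P. P \<subseteq> r ` S - r ` Q \<and> card P = k}"
        by (auto simp: card_image inj_on_subset[OF inj] inj_eq[OF inj])
    next
      fix P assume "P \<in> {P. P \<subseteq> r ` S - r ` Q \<and> card P = k}"
      then have "P \<subseteq> r ` (S - Q)" "card P = k" by (simp_all add: image_set_diff[OF inj])
      then show "r ` P \<in> {P. P \<subseteq> S - Q \<and> card P = k}"
        using image_mono[of P "r ` (S - Q)" r]
        by (simp add: rr_image card_image inj_on_subset[OF inj])
    qed (simp_all add: rr_image)
    ultimately show ?thesis by (simp add: G_def inj_image_subset_iff[OF inj])
  qed
  then have "(\<Sum>S\<in>\<F>. G (\<lambda>P. z (r ` P)) Q S) = (\<Sum>S\<in>\<F>. G z (r ` Q) (r ` S))" by simp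
  also have "\<dots> = (\<Sum>S\<in>\<F>. G z (r ` Q) S)"
    using r by (intro sum.reindex_bij_witness[of _ "image r" "image r"])
      (auto simp: rr_image face_symmetry_def)
  also have "\<dots> = 0"
    using sys[unfolded weight_system_def, rule_format, of "r ` Q"] Q r
    by (auto simp: G_def face_symmetry_def card_image inj_on_subset[OF inj])
  finally show "(\<Sum>S\<in>\<F>. if Q \<subseteq> S then face_weight a S *
      (\<Sum>P | P \<subseteq> S - Q \<and> card P = k. z (r ` P)) else 0) = 0"
    by (simp add: G_def)
qed

lemma weight_system_add:
  assumes "weight_system a k y" "weight_system a k z"
  shows "weight_system a k (\<lambda>P. y P + e * z P)"
  unfolding weight_system_def
proof (intro allI impI)
  fix Q assume Q: "Q \<subseteq> V \<and> card Q = k"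
  have "(\<Sum>S\<in>\<F>. if Q \<subseteq> S then face_weight a S *
        (\<Sum>P | P \<subseteq> S - Q \<and> card P = k. y P + e * z P) else 0)
    = (\<Sum>S\<in>\<F>. if Q \<subseteq> S then face_weight a S * (\<Sum>P | P \<subseteq> S - Q \<and> card P = k. y P) else 0)
      + e * (\<Sum>S\<in>\<F>. if Q \<subseteq> S then face_weight a S * (\<Sum>P | P \<subseteq> S - Q \<and> card P = k. z P) else 0)"
    unfolding sum_distrib_left sum.distrib[symmetric]
    by (intro sum.cong) (auto simp: sum.distrib sum_distrib_left algebra_simps)
  then show "(\<Sum>S\<in>\<F>. if Q \<subseteq> S then face_weight a S *
        (\<Sum>P | P \<subseteq> S - Q \<and> card P = k. y P + e * z P) else 0) = 0"
    using assms Q by (simp add: weight_system_def)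
qed

text \<open>
If \<open>z\<close> solves the system then so do its even and odd parts \<open>z \<plusminus> z \<circ> r\<close>, and \<open>z\<close> is their mean. As the
symmetries commute, the parities already achieved are kept when the next symmetry is treated.
\<close>

lemma weight_system_vanish_by_parity:
  assumes fin: "finite R"
    and symm: "\<And>r. r \<in> R \<Longrightarrow> face_symmetry a r"
    and comm: "\<And>r r' v. r \<in> R \<Longrightarrow> r' \<in> R \<Longrightarrow> r (r' v) = r' (r v)"
    and parity: "\<And>y. weight_system a k y \<Longrightarrow>
      (\<And>r. r \<in> R \<Longrightarrow> \<exists>e\<in>{1,
        - 1}. \<forall>P. y (r ` P) = e * y P) \<Longrightarrow> y P\<^sub>0 = 0"
    and sys: "weight_system a k z"
  shows "z P\<^sub>0 = 0"
proof -
  have "\<lbrakk>weight_system a k z; \<And>r. r \<in> R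
    - R' \<Longrightarrow> \<exists>e\<in>{1,
    - 1}. \<forall>P. z (r ` P) = e * z P\<rbrakk> \<Longrightarrow> z P\<^sub>0 = 0"
    if "finite R'" "R' \<subseteq> R" for R' z
    using that
  proof (induction R' arbitrary: z rule: finite_induct)
    case empty
    then show ?case using parity by simp
  next
    case (insert r R')
    then have r: "r \<in> R" by simp
    have z_sys: "weight_system a k z" by (rule insert.prems)
    have z_parity: "\<exists>e\<in>{1, - 1}. \<forall>P. z (r' ` P) = e * z P" if "r' \<in> R - insert r R'" for r'
      using that by (rule insert.prems)
    have "z P\<^sub>0 + e * z (r ` P\<^sub>0) = 0" if e: "e \<in> {1, - 1}" for e :: real
    proof (rule insert.IH[where z = "\<lambda>P. z P + e * z (r ` P)"])
      show "R' \<subseteq> R" using insert.prems by simp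
      show "weight_system a k (\<lambda>P. z P + e * z (r ` P))"
        by (intro weight_system_add weight_system_symmetry[OF symm[OF r]] z_sys)
    next
      fix r' assume r': "r' \<in> R - R'"
      show "\<exists>e'\<in>{1, - 1}. \<forall>P. z (r' ` P) + e * z (r ` r' ` P) = e' * (z P + e * z (r ` P))"
      proof (cases "r' = r")
        case True
        have "r ` r ` P = P" for P
          using symm[OF r] by (simp add: face_symmetry_def image_image)
        moreover have "e * e = 1" using e by auto
        ultimately show ?thesis using e True
          by (intro bexI[of _ e]) (simp_all add: algebra_simps flip: mult.assoc)
      next
        case False
        then obtain e' where e': "e' \<in> {1, - 1}" "\<And>P. z (r' ` P) = e' * z P"
          using z_parity[of r'] r' by blast
        have "r ` r' ` P = r' ` r ` P" for P
          using comm[OF r, of r'] r' by (simp add: image_image)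
        then show ?thesis using e' by (intro bexI[of _ e']) (simp_all add: algebra_simps)
      qed
    qed
    from this[of 1] this[of "- 1"] show ?case by simp
  qed
  from this[OF fin order.refl sys] show ?thesis by simp
qed

end

section \<open>The Platonic solids\<close>

fun face_size :: "platonic \<Rightarrow> nat" where
  "face_size Tetrahedron = 3"
| "face_size Hexahedron = 4"
| "face_size Octahedron = 3"
| "face_size Dodecahedron = 5"
| "face_size Icosahedron = 3"

lemma facets_platonic: "facets (vertices P) (faces P) (face_size P)"
  by unfold_locales (cases P; auto)+

lemma face_poly_eq: "face_poly P = facet_poly (faces P)"
  by (simp add: face_poly_def facet_poly_def)

text \<open>
The faces are pairwise distinct, so sums over the set of faces may be written out.
\<close>

lemma sum_faces:
  fixes g :: "nat set \<Rightarrow> real"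
  shows "sum g (faces Tetrahedron) = g {1,2,3} + g {1,2,4} + g {1,3,4} + g {2,3,4}"
    and "sum g (faces Hexahedron) = g {1,2,3,4} + g {2,3,6,7} + g {3,4,7,8} + g {1,4,5,8}
      + g {1,2,5,6} + g {5,6,7,8}"
    and "sum g (faces Octahedron) = g {1,2,3} + g {1,3,4} + g {1,4,5} + g {1,2,5} + g {2,3,6}
      + g {3,4,6} + g {4,5,6} + g {2,5,6}"
    and "sum g (faces Icosahedron) = g {1,2,3} + g {1,3,4} + g {1,4,5} + g {3,4,9} + g {1,5,6}
      + g {1,2,6} + g {2,3,8} + g {3,8,9} + g {2,6,7} + g {2,7,8} + g {10,11,12} + g {4,5,10}
      + g {4,9,10} + g {5,6,11} + g {5,10,11} + g {9,10,12} + g {8,9,12} + g {6,7,11}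
      + g {7,11,12} + g {7,8,12}"
    and "sum g (faces Dodecahedron) = g {1,2,3,4,5} + g {1,2,6,7,19} + g {2,3,7,8,20}
      + g {3,4,8,9,16} + g {4,5,9,10,17} + g {1,5,6,10,18} + g {11,12,13,14,15}
      + g {11,12,16,17,9} + g {12,13,17,18,10} + g {13,14,18,19,6} + g {14,15,19,20,7}
      + g {11,15,16,20,8}"
  by (simp_all add: set_eq_subset add.assoc)

section \<open>Tetrahedron and octahedron\<close>

text \<open>
With \<open>W\<close> the sum of the \<open>w\<^sub>i\<close> and \<open>m\<close>, \<open>M\<close> the extreme values, the left-hand side equals
\<open>w\<^sub>2 (c-m)(c-M) + w\<^sub>3 (d-m)(d-M) - W (c\<^sup>2+cd+d\<^sup>2)\<close> modulo the hypothesis \<open>prim\<close>, and none of the three terms is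
positive.
\<close>

lemma tetrahedron_inequality_sorted:
  fixes w1 w2 w3 w4 m c d M :: real
  assumes w: "w1 > 0" "w2 > 0" "w3 > 0" "w4 > 0"
    and sorted: "m \<le> c" "c \<le> M" "m \<le> d" "d \<le> M"
    and prim: "w1 * (c + d + M) + w2 * (m + d + M) + w3 * (m + c + M) + w4 * (m + c + d) = 0"
    and nz: "\<not> (m = 0 \<and> c = 0 \<and> d = 0 \<and> M = 0)"
  shows "w1 * (c*d + c*M + d*M) + w2 * (m*d + m*M + d*M) + w3 * (m*c + m*M + c*M)
    + w4 * (m*c + m*d + c*d) < 0" (is "?E < 0")
proof -
  let ?W = "w1 + w2 + w3 + w4" and ?U =
    "w1 * (c + d + M) + w2 * (m + d + M) + w3 * (m + c + M) + w4 * (m + c + d)"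
  have "?E = w2 * ((c - m) * (c - M)) + w3 * ((d - m) * (d - M)) - ?W * (c\<^sup>2 + c * d + d\<^sup>2) + (c + d) * ?U"
    by (simp add: algebra_simps power2_eq_square)
  then have E: "?E = w2 * ((c - m) * (c - M)) + w3 * ((d - m) * (d - M)) - ?W * (c\<^sup>2 + c * d + d\<^sup>2)"
    using prim by simp
  have cm: "w2 * ((c - m) * (c - M)) \<le> 0" "w3 * ((d - m) * (d - M)) \<le> 0"
    using w sorted by (auto intro!: mult_nonneg_nonpos)
  have sq: "c\<^sup>2 + c * d + d\<^sup>2 = (c\<^sup>2 + d\<^sup>2 + (c + d)\<^sup>2) / 2"
    by (simp add: power2_eq_square algebra_simps)
  show ?thesis
  proof (cases "c = 0 \<and> d = 0")
    case False
    then have "c\<^sup>2 + c * d + d\<^sup>2 > 0"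
      unfolding sq by (metis add_pos_nonneg add_nonneg_pos half_gt_zero zero_le_power2
        zero_less_power2)
    then have "?W * (c\<^sup>2 + c * d + d\<^sup>2) > 0" using w by simp
    then show ?thesis using E cm by linarith
  next
    case True
    have "m \<noteq> 0 \<and> M \<noteq> 0"
    proof (rule ccontr)
      assume "\<not> (m \<noteq> 0 \<and> M \<noteq> 0)"
      then have "m = 0 \<or> M = 0" by blast
      then show False
      proof
        assume "m = 0"
        then have "(w1 + w2 + w3) * M = 0" using prim True by (simp add: algebra_simps)
        then show False using w nz True \<open>m = 0\<close> by simp
      next
        assume "M = 0"
        then have "(w2 + w3 + w4) * m = 0" using prim True by (simp add: algebra_simps)
        then show False using w nz True \<open>M = 0\<close> by simp
      qed
    qed
    then have "m * M < 0" using sorted True by (auto simp: mult_less_0_iff)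
    then have "(w2 + w3) * (m * M) < 0" using w by (simp add: mult_pos_neg)
    then show ?thesis using True by (simp add: algebra_simps)
  qed
qed

text \<open>
The statement is symmetric in the four pairs \<open>(w\<^sub>i, z\<^sub>i)\<close>, so the variables may be ordered.
\<close>

lemma tetrahedron_inequality:
  fixes w1 w2 w3 w4 a b c d :: real
  assumes w: "w1 > 0" "w2 > 0" "w3 > 0" "w4 > 0"
    and prim: "w1 * (b + c + d) + w2 * (a + c + d) + w3 * (a + b + d) + w4 * (a + b + c) = 0"
    and nz: "\<not> (a = 0 \<and> b = 0 \<and> c = 0 \<and> d = 0)"
  shows "w1 * (b*c + b*d + c*d) + w2 * (a*c + a*d + c*d) + w3 * (a*b + a*d + b*d)
    + w4 * (a*b + a*c + b*c) < 0"
proof -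
  note core = tetrahedron_inequality_sorted
  \<comment> \<open>The cases list which variable is smallest and which is largest.\<close>
  consider "a \<le> b" "b \<le> d" "a \<le> c" "c \<le> d" | "d \<le> b" "b \<le> a" "d \<le> c" "c \<le> a"
    | "a \<le> b" "b \<le> c" "a \<le> d" "d \<le> c" | "c \<le> b" "b \<le> a" "c \<le> d" "d \<le> a"
    | "a \<le> c" "c \<le> b" "a \<le> d" "d \<le> b" | "b \<le> c" "c \<le> a" "b \<le> d" "d \<le> a"
    | "b \<le> a" "a \<le> c" "b \<le> d" "d \<le> c" | "c \<le> a" "a \<le> b" "c \<le> d" "d \<le> b"
    | "b \<le> a" "a \<le> d" "b \<le> c" "c \<le> d" | "d \<le> a" "a \<le> b" "d \<le> c" "c \<le> b"
    | "c \<le> a" "a \<le> d" "c \<le> b" "b \<le> d" | "d \<le> a" "a \<le> c" "d \<le> b" "b \<le> c"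
    by (smt (verit))
  then show ?thesis
  proof cases
    case 1 then show ?thesis using core[of w1 w2 w3 w4 a b d c] assms by (auto simp: algebra_simps)
  next
    case 2 then show ?thesis using core[of w4 w2 w3 w1 d b a c] assms by (auto simp: algebra_simps)
  next
    case 3 then show ?thesis using core[of w1 w2 w4 w3 a b c d] assms by (auto simp: algebra_simps)
  next
    case 4 then show ?thesis using core[of w3 w2 w4 w1 c b a d] assms by (auto simp: algebra_simps)
  next
    case 5 then show ?thesis using core[of w1 w3 w4 w2 a c b d] assms by (auto simp: algebra_simps)
  next
    case 6 then show ?thesis using core[of w2 w3 w4 w1 b c a d] assms by (auto simp: algebra_simps)
  next
    case 7 then show ?thesis using core[of w2 w1 w4 w3 b a c d] assms by (auto simp: algebra_simps)
  next
    case 8 then show ?thesis using core[of w3 w1 w4 w2 c a b d] assms by (auto simp: algebra_simps)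
  next
    case 9 then show ?thesis using core[of w2 w1 w3 w4 b a d c] assms by (auto simp: algebra_simps)
  next
    case 10 then show ?thesis using core[of w4 w1 w3 w2 d a b c] assms by (auto simp: algebra_simps)
  next
    case 11 then show ?thesis using core[of w3 w1 w2 w4 c a d b] assms by (auto simp: algebra_simps)
  next
    case 12 then show ?thesis using core[of w4 w1 w2 w3 d a c b] assms by (auto simp: algebra_simps)
  qed
qed

text \<open>
After the substitution \<open>c\<^sub>v = a\<^sub>v z\<^sub>v\<close> the coefficients \<open>w\<^sub>i\<close> of the inequality are the face weights.
\<close>

lemma hodge_riemann_tetrahedron:
  assumes a: "\<forall>v\<in>vertices Tetrahedron. a v > 0"
  shows "hodge_riemann_relation (vertices Tetrahedron) (facet_poly (faces Tetrahedron))
    (cls (vertices Tetrahedron) (facet_poly (faces Tetrahedron)) (linear_form (vertices Tetrahedron) a))"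
proof -
  interpret facets "vertices Tetrahedron" "faces Tetrahedron" 3
    using facets_platonic[of Tetrahedron] by simp
  have pos: "a 1 > 0" "a 2 > 0" "a 3 > 0" "a 4 > 0" using a by auto
  show ?thesis
  proof (rule hodge_riemann_cubic[OF refl])
    show "0 < (\<Sum>S\<in>faces Tetrahedron. face_weight a S)"
      unfolding sum_faces using pos by (simp add: face_weight_def add_pos_pos)
  next
    fix c
    assume prim: "(\<Sum>S\<in>faces Tetrahedron. \<Sum>v\<in>S. c v * face_weight a (S - {v})) = 0"
      and nz: "linear_form (vertices Tetrahedron) c
        \<notin> Ann (vertices Tetrahedron) (facet_poly (faces Tetrahedron))"
    define z where "z v = c v / a v" for v
    have c: "c 1 = a 1 * z 1" "c 2 = a 2 * z 2" "c 3 = a 3 * z 3" "c 4 = a 4 * z 4"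
      using pos by (auto simp: z_def)
    have "\<not> (z 1 = 0 \<and> z 2 = 0 \<and> z 3 = 0 \<and> z 4 = 0)"
    proof
      assume "z 1 = 0 \<and> z 2 = 0 \<and> z 3 = 0 \<and> z 4 = 0"
      then have "c v = 0" if "v \<in> {1..4}" for v
      proof -
        have "v = 1 \<or> v = 2 \<or> v = 3 \<or> v = 4" using that by auto
        then show ?thesis using c \<open>z 1 = 0 \<and> z 2 = 0 \<and> z 3 = 0 \<and> z 4 =
          0\<close> by auto
      qed
      then have "linear_form (vertices Tetrahedron) c = 0"
        unfolding linear_form_def by (intro sum.neutral) (simp add: Const_def)
      then show False using nz Ann_zero by simp
    qed
    moreover have "(a 2 * a 3 * a 4) * (z 2 + z 3 + z 4) + (a 1 * a 3 * a 4) * (z 1 + z 3 + z 4)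
        + (a 1 * a 2 * a 4) * (z 1 + z 2 + z 4) + (a 1 * a 2 * a 3) * (z 1 + z 2 + z 3) = 0"
      using prim unfolding sum_faces by (simp add: face_weight_def insert_Diff_if c algebra_simps
        del: One_nat_def)
    ultimately have "(a 2 * a 3 * a 4) * (z 2 * z 3 + z 2 * z 4 + z 3 * z 4)
        + (a 1 * a 3 * a 4) * (z 1 * z 3 + z 1 * z 4 + z 3 * z 4)
        + (a 1 * a 2 * a 4) * (z 1 * z 2 + z 1 * z 4 + z 2 * z 4)
        + (a 1 * a 2 * a 3) * (z 1 * z 2 + z 1 * z 3 + z 2 * z 3) < 0"
      using tetrahedron_inequality[of "a 2 * a 3 * a 4" "a 1 * a 3 * a 4" "a 1 * a 2 * a 4"
          "a 1 * a 2 * a 3" "z 2" "z 3" "z 4" "z 1"] pos by simp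
    then show "(\<Sum>S\<in>faces Tetrahedron. \<Sum>v\<in>S. a v * face_weight c (S - {v})) < 0"
      unfolding sum_faces by (simp add: face_weight_def insert_Diff_if c algebra_simps del:
        One_nat_def)
  qed
qed

text \<open>
For \<open>t\<^sub>i = y\<^sub>i / b\<^sub>i\<close> the hypothesis says \<open>t\<^sub>1 + t\<^sub>2 + t\<^sub>3 = 0\<close>, and then
\<open>2 (t\<^sub>1 t\<^sub>2 + t\<^sub>1 t\<^sub>3 + t\<^sub>2 t\<^sub>3) = - (t\<^sub>1\<^sup>2 + t\<^sub>2\<^sup>2 + t\<^sub>3\<^sup>2)\<close>.
\<close>

lemma octahedron_inequality:
  fixes b1 b2 b3 y1 y2 y3 :: real
  assumes b: "b1 > 0" "b2 > 0" "b3 > 0"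
    and prim: "y1 * b2 * b3 + b1 * y2 * b3 + b1 * b2 * y3 = 0"
    and nz: "\<not> (y1 = 0 \<and> y2 = 0 \<and> y3 = 0)"
  shows "b1 * y2 * y3 + y1 * b2 * y3 + y1 * y2 * b3 < 0"
proof -
  define t1 t2 t3 where t: "t1 = y1 / b1" "t2 = y2 / b2" "t3 = y3 / b3"
  have y: "y1 = b1 * t1" "y2 = b2 * t2" "y3 = b3 * t3" using b by (auto simp: t)
  have "b1 * b2 * b3 * (t1 + t2 + t3) = 0" using prim unfolding y by (simp add: algebra_simps)
  then have t3: "t3 = - t1 - t2" using b by simp
  have nz': "t1 \<noteq> 0 \<or> t2 \<noteq> 0" using nz unfolding y t3 by auto
  have "0 < t1\<^sup>2 + t2\<^sup>2 + (t1 + t2)\<^sup>2"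
    using nz' by (metis add_pos_nonneg add_nonneg_pos zero_le_power2 zero_less_power2)
  then have "0 < b1 * b2 * b3 * (t1\<^sup>2 + t2\<^sup>2 + (t1 + t2)\<^sup>2)" using b by simp
  moreover have "2 * (b1 * y2 * y3 + y1 * b2 * y3 + y1 * y2 * b3)
      = - (b1 * b2 * b3 * (t1\<^sup>2 + t2\<^sup>2 + (t1 + t2)\<^sup>2))"
    unfolding y t3 by (simp add: algebra_simps power2_eq_square)
  ultimately have "2 * (b1 * y2 * y3 + y1 * b2 * y3 + y1 * y2 * b3) < 0"
    by (simp only: neg_less_0_iff_less)
  moreover have "2 * x < 0 \<Longrightarrow> x < 0" for x :: real by simp
  ultimately show ?thesis by blast
qed

text \<open>
Every face contains one vertex of each of the antipodal pairs \<open>{1,6}\<close>, \<open>{2,4}\<close>, \<open>{3,5}\<close>, so everything depends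
only on the three sums over these pairs.
\<close>

lemma hodge_riemann_octahedron:
  assumes a: "\<forall>v\<in>vertices Octahedron. a v > 0"
  shows "hodge_riemann_relation (vertices Octahedron) (facet_poly (faces Octahedron))
    (cls (vertices Octahedron) (facet_poly (faces Octahedron)) (linear_form (vertices Octahedron) a))"
proof -
  interpret facets "vertices Octahedron" "faces Octahedron" 3
    using facets_platonic[of Octahedron] by simp
  have pos: "a 1 > 0" "a 2 > 0" "a 3 > 0" "a 4 > 0" "a 5 > 0" "a 6 > 0" using a by auto
  have polar: "(\<Sum>S\<in>faces Octahedron. \<Sum>v\<in>S. c v * face_weight a (S - {v}))
      = (c 1 + c 6) * (a 2 + a 4) * (a 3 + a 5) + (a 1 + a 6) * (c 2 + c 4) * (a 3 + a 5)
        + (a 1 + a 6) * (a 2 + a 4) * (c 3 + c 5)" for a c :: "nat \<Rightarrow> real"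
    unfolding sum_faces
    by (simp add: face_weight_def insert_Diff_if algebra_simps del: One_nat_def)
  show ?thesis
  proof (rule hodge_riemann_cubic[OF refl])
    show "0 < (\<Sum>S\<in>faces Octahedron. face_weight a S)"
      unfolding sum_faces using pos by (simp add: face_weight_def add_pos_pos)
  next
    fix c
    assume prim: "(\<Sum>S\<in>faces Octahedron. \<Sum>v\<in>S. c v * face_weight a (S - {v})) = 0"
      and nz: "linear_form (vertices Octahedron) c
        \<notin> Ann (vertices Octahedron) (facet_poly (faces Octahedron))"
    have "\<not> (c 1 + c 6 = 0 \<and> c 2 + c 4 = 0 \<and> c 3 + c 5 = 0)"
    proof
      assume eq: "c 1 + c 6 = 0 \<and> c 2 + c 4 = 0 \<and> c 3 + c 5 = 0"
      have "(\<Sum>S\<in>faces Octahedron. if Q \<subseteq> S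
            then lookup (linear_form (vertices Octahedron) c) (sqf (S - Q)) else 0) = 0"
        if Q: "Q \<subseteq> vertices Octahedron" "card Q + 1 = 3" for Q
      proof -
        obtain u v where uv: "Q = {u, v}" "u \<noteq> v"
          using Q(2) card_2_iff[of Q] by auto
        have "u \<in> {1,2,3,4,5,6}" "v \<in> {1,2,3,4,5,6}" using Q(1) uv by auto
        then show ?thesis
          unfolding sum_faces uv(1) using uv(2) eq
          by (auto simp: insert_Diff_if lookup_linear_form add.commute simp del: One_nat_def)
      qed
      then have "linear_form (vertices Octahedron) c
          \<in> Ann (vertices Octahedron) (facet_poly (faces Octahedron))"
        unfolding mem_Ann_facet_iff[OF linear_form_closed homogeneous_linear_form] by blast
      then show False using nz by simp
    qed
    then have "(a 1 + a 6) * (c 2 + c 4) * (c 3 + c 5) + (c 1 + c 6) * (a 2 + a 4) * (c 3 + c 5)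
        + (c 1 + c 6) * (c 2 + c 4) * (a 3 + a 5) < 0"
      using prim pos unfolding polar by (intro octahedron_inequality) auto
    then show "(\<Sum>S\<in>faces Octahedron. \<Sum>v\<in>S. a v * face_weight c (S - {v})) < 0"
      unfolding polar .
  qed
qed

section \<open>Icosahedron and hexahedron\<close>

text \<open>
With equal weights the vertex system says that the sum \<open>n\<^sub>u\<close> of \<open>z\<close> over the five neighbours of \<open>u\<close>
vanishes for each \<open>u\<close>. Two vertices at distance one or two have exactly two common neighbours, and the
vertices at distance two from \<open>u\<close> are the neighbours of its antipode \<open>u'\<close>. Therefore
\<open>5 z\<^sub>u + 2 n\<^sub>u + 2 n\<^bsub>u'\<^esub>\<close> is the sum of the \<open>n\<^sub>v\<close> over the neighbours \<open>v\<close> of \<open>u\<close>, and \<open>z\<^sub>u = 0\<close>.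
\<close>

lemma icosahedron_lefschetz_without_hodge_riemann:
  shows "strong_lefschetz_element (vertices Icosahedron) (facet_poly (faces Icosahedron))
      (cls (vertices Icosahedron) (facet_poly (faces Icosahedron))
        (linear_form (vertices Icosahedron) (\<lambda>_. - 1)))" (is ?SL)
    and "\<not> hodge_riemann_relation (vertices Icosahedron) (facet_poly (faces Icosahedron))
      (cls (vertices Icosahedron) (facet_poly (faces Icosahedron))
        (linear_form (vertices Icosahedron) (\<lambda>_. - 1)))" (is ?HR)
proof -
  interpret facets "vertices Icosahedron" "faces Icosahedron" 3
    using facets_platonic[of Icosahedron] by simp
  let ?a = "\<lambda>_ :: nat. - 1 :: real"
  have w: "face_weight ?a S = - 1" if "S \<in> faces Icosahedron" for S
    using card_facet[OF that] by (simp add: face_weight_def)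
  have total: "(\<Sum>S\<in>faces Icosahedron. face_weight ?a S) < 0"
    unfolding sum_faces by (simp add: face_weight_def)
  show ?HR by (rule not_hodge_riemann_of_negative[OF total])
  show ?SL
  proof (rule strong_lefschetz_of_vertex_system)
    fix z :: "nat \<Rightarrow> real" and v
    assume sys: "\<And>u. u \<in> vertices Icosahedron \<Longrightarrow> (\<Sum>S\<in>faces Icosahedron.
        if u \<in> S then face_weight ?a S * (\<Sum>v\<in>S - {u}. z v) else 0) = 0"
      and v: "v \<in> vertices Icosahedron"
    have eqs: "(\<Sum>S\<in>faces Icosahedron. if u \<in> S then \<Sum>v\<in>S - {u}. z v else 0) = 0"
      if "u \<in> {1..12}" for u
    proof -
      have "(\<Sum>S\<in>faces Icosahedron. if u \<in> S then \<Sum>v\<in>S - {u}. z v else 0)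
          = - (\<Sum>S\<in>faces Icosahedron. if u \<in> S then face_weight ?a S * (\<Sum>v\<in>S - {u}. z v) else 0)"
        unfolding sum_negf[symmetric] by (intro sum.cong) (auto simp: w)
      then show ?thesis using sys[of u] that by simp
    qed
    note eqs' = eqs[unfolded sum_faces]
    have n1: "z 2 + z 3 + z 4 + z 5 + z 6 = 0" using eqs'[of 1] by (simp add: insert_Diff_if)
    have n2: "z 1 + z 3 + z 6 + z 7 + z 8 = 0" using eqs'[of 2] by (simp add: insert_Diff_if)
    have n3: "z 1 + z 2 + z 4 + z 8 + z 9 = 0" using eqs'[of 3] by (simp add: insert_Diff_if)
    have n4: "z 1 + z 3 + z 5 + z 9 + z 10 = 0" using eqs'[of 4] by (simp add: insert_Diff_if)
    have n5: "z 1 + z 4 + z 6 + z 10 + z 11 = 0" using eqs'[of 5] by (simp add: insert_Diff_if)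
    have n6: "z 1 + z 2 + z 5 + z 7 + z 11 = 0" using eqs'[of 6] by (simp add: insert_Diff_if)
    have n7: "z 2 + z 6 + z 8 + z 11 + z 12 = 0" using eqs'[of 7] by (simp add: insert_Diff_if)
    have n8: "z 2 + z 3 + z 7 + z 9 + z 12 = 0" using eqs'[of 8] by (simp add: insert_Diff_if)
    have n9: "z 3 + z 4 + z 8 + z 10 + z 12 = 0" using eqs'[of 9] by (simp add: insert_Diff_if)
    have n10: "z 4 + z 5 + z 9 + z 11 + z 12 = 0" using eqs'[of 10] by (simp add: insert_Diff_if)
    have n11: "z 5 + z 6 + z 7 + z 10 + z 12 = 0" using eqs'[of 11] by (simp add: insert_Diff_if)
    have n12: "z 7 + z 8 + z 9 + z 10 + z 11 = 0" using eqs'[of 12] by (simp add: insert_Diff_if)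
    have z1: "z 1 = 0" using n1 n12 n2 n3 n4 n5 n6 by linarith
    have z2: "z 2 = 0" using n2 n10 n1 n3 n6 n7 n8 by linarith
    have z3: "z 3 = 0" using n3 n11 n1 n2 n4 n8 n9 by linarith
    have z4: "z 4 = 0" using n4 n7 n1 n3 n5 n9 n10 by linarith
    have z5: "z 5 = 0" using n5 n8 n1 n4 n6 n10 n11 by linarith
    have z6: "z 6 = 0" using n6 n9 n1 n2 n5 n7 n11 by linarith
    have z7: "z 7 = 0" using n7 n4 n2 n6 n8 n11 n12 by linarith
    have z8: "z 8 = 0" using n8 n5 n2 n3 n7 n9 n12 by linarith
    have z9: "z 9 = 0" using n9 n6 n3 n4 n8 n10 n12 by linarith
    have z10: "z 10 = 0" using n10 n2 n4 n5 n9 n11 n12 by linarith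
    have z11: "z 11 = 0" using n11 n3 n5 n6 n7 n10 n12 by linarith
    have z12: "z 12 = 0" using n12 n1 n7 n8 n9 n10 n11 by linarith
    have "v \<in> {1,2,3,4,5,6,7,8,9,10,11,12}"
      using v unfolding vertices.simps atLeastAtMost_iff insert_iff empty_iff by presburger
    then show "z v = 0" using z1 z2 z3 z4 z5 z6 z7 z8 z9 z10 z11 z12 by auto
  qed (use total in auto)
qed

text \<open>
The three faces at vertex \<open>1\<close> have weight \<open>-2\<close> and the other three have weight \<open>1\<close>, with sum \<open>-3\<close>.
A constant \<open>a\<close> would not do: as \<open>s = 4\<close> is even, its face weights are positive for either sign.
\<close>

lemma hexahedron_lefschetz_without_hodge_riemann:
  fixes a :: "nat \<Rightarrow> real"
  defines "a \<equiv> (\<lambda>v. if v = 1 then - 2 else 1)"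
  shows "strong_lefschetz_element (vertices Hexahedron) (facet_poly (faces Hexahedron))
      (cls (vertices Hexahedron) (facet_poly (faces Hexahedron)) (linear_form (vertices Hexahedron) a))"
      (is ?SL)
    and "\<not> hodge_riemann_relation (vertices Hexahedron) (facet_poly (faces Hexahedron))
      (cls (vertices Hexahedron) (facet_poly (faces Hexahedron)) (linear_form (vertices Hexahedron) a))"
      (is ?HR)
proof -
  interpret facets "vertices Hexahedron" "faces Hexahedron" 4
    using facets_platonic[of Hexahedron] by simp
  have total: "(\<Sum>S\<in>faces Hexahedron. face_weight a S) < 0"
    unfolding sum_faces by (simp add: face_weight_def a_def)
  show ?HR by (rule not_hodge_riemann_of_negative[OF total])
  show ?SL
  proof (rule strong_lefschetz_of_vertex_system)
    fix z :: "nat \<Rightarrow> real" and v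
    assume sys: "\<And>u. u \<in> vertices Hexahedron \<Longrightarrow> (\<Sum>S\<in>faces Hexahedron.
        if u \<in> S then face_weight a S * (\<Sum>v\<in>S - {u}. z v) else 0) = 0"
      and v: "v \<in> vertices Hexahedron"
    note eqs = sys[unfolded sum_faces]
    have n1: "(-4) * z 2 + (-2) * z 3 + (-4) * z 4 + (-4) * z 5 + (-2) * z 6 + (-2) * z 8 = 0"
      using eqs[of 1] by (simp add: insert_Diff_if face_weight_def a_def)
    have n2: "(-4) * z 1 + (-1) * z 3 + (-2) * z 4 + (-2) * z 5 + (-1) * z 6 + (1) * z 7 = 0"
      using eqs[of 2] by (simp add: insert_Diff_if face_weight_def a_def)
    have n3: "(-2) * z 1 + (-1) * z 2 + (-1) * z 4 + (1) * z 6 + (2) * z 7 + (1) * z 8 = 0"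
      using eqs[of 3] by (simp add: insert_Diff_if face_weight_def a_def)
    have n4: "(-4) * z 1 + (-2) * z 2 + (-1) * z 3 + (-2) * z 5 + (1) * z 7 + (-1) * z 8 = 0"
      using eqs[of 4] by (simp add: insert_Diff_if face_weight_def a_def)
    have n5: "(-4) * z 1 + (-2) * z 2 + (-2) * z 4 + (-1) * z 6 + (1) * z 7 + (-1) * z 8 = 0"
      using eqs[of 5] by (simp add: insert_Diff_if face_weight_def a_def)
    have n6: "(-2) * z 1 + (-1) * z 2 + (1) * z 3 + (-1) * z 5 + (2) * z 7 + (1) * z 8 = 0"
      using eqs[of 6] by (simp add: insert_Diff_if face_weight_def a_def)
    have n7: "(1) * z 2 + (2) * z 3 + (1) * z 4 + (1) * z 5 + (2) * z 6 + (2) * z 8 = 0"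
      using eqs[of 7] by (simp add: insert_Diff_if face_weight_def a_def)
    have n8: "(-2) * z 1 + (1) * z 3 + (-1) * z 4 + (-1) * z 5 + (1) * z 6 + (2) * z 7 = 0"
      using eqs[of 8] by (simp add: insert_Diff_if face_weight_def a_def)
    have z1: "z 1 = 0" using n1 n2 n3 n4 n5 n6 n7 n8 by linarith
    have z2: "z 2 = 0" using n1 n2 n3 n4 n5 n6 n7 n8 by linarith
    have z3: "z 3 = 0" using n1 n2 n3 n4 n5 n6 n7 n8 by linarith
    have z4: "z 4 = 0" using n1 n2 n3 n4 n5 n6 n7 n8 by linarith
    have z5: "z 5 = 0" using n1 n2 n3 n4 n5 n6 n7 n8 by linarith
    have z6: "z 6 = 0" using n1 n2 n3 n4 n5 n6 n7 n8 by linarith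
    have z7: "z 7 = 0" using n1 n2 n3 n4 n5 n6 n7 n8 by linarith
    have z8: "z 8 = 0" using n1 n2 n3 n4 n5 n6 n7 n8 by linarith
    have "v \<in> {1,2,3,4,5,6,7,8}"
      using v unfolding vertices.simps atLeastAtMost_iff insert_iff empty_iff by presburger
    then show "z v = 0" using z1 z2 z3 z4 z5 z6 z7 z8 by auto
  qed (use total in \<open>auto simp: a_def\<close>)
qed

section \<open>Dodecahedron\<close>

lemma sum_pairs_of_triple:
  assumes "distinct [x, y, w]"
  shows "(\<Sum>P | P \<subseteq> {x, y, w} \<and> card P = 2. z P) = z {x, y} + z {x, w} + (z {y, w} :: real)"
proof -
  have "{P. P \<subseteq> {x, y, w} \<and> card P = 2} = {{x, y}, {x, w}, {y, w}}"
    using assms by (auto simp: card_2_iff)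
  moreover have "{x, y} \<noteq> {x, w}" "{x, y} \<noteq> {y, w}" "{x, w} \<noteq> {y, w}"
    using assms by (auto simp: doubleton_eq_iff)
  ultimately show ?thesis by (simp add: add.assoc)
qed

text \<open>
The contribution of the face \<open>S\<close> to the equation of \<open>Q\<close> in the system for \<open>k = 2\<close>, without the weight.
\<close>

definition pair_sum :: "(nat set \<Rightarrow> real) \<Rightarrow> nat set \<Rightarrow> nat set \<Rightarrow> real" where
  "pair_sum z S Q = (\<Sum>P | P \<subseteq> S - Q \<and> card P = 2. z P)"

text \<open>
A diagonal of a pentagon lies in no other face, so its equation involves this pentagon only. The five
diagonal equations express the five diagonal unknowns by the edge unknowns: each of the equations couples the
two diagonals that cross a given one, and a system along a cycle of odd length is uniquely
solvable. What is left are equations between edge unknowns.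
\<close>

lemma pentagon_elimination:
  fixes z :: "nat set \<Rightarrow> real"
  assumes dist: "distinct [v0, v1, v2, v3, v4]" and S: "S = {v0, v1, v2, v3, v4}"
    and diag: "pair_sum z S {v0, v2} = 0" "pair_sum z S {v1, v3} = 0" "pair_sum z S {v2, v4} = 0"
      "pair_sum z S {v3, v0} = 0" "pair_sum z S {v4, v1} = 0"
  shows "2 * pair_sum z S {v0, v1} = 3 * z {v2, v3} + 3 * z {v3, v4} - z {v0, v1} - z {v1, v2} - z {v4, v0}"
      (is ?edge)
    and "z {v0, v1} = 0 \<Longrightarrow> z {v1, v2} = 0 \<Longrightarrow> z {v2, v3} = 0 \<Longrightarrow> z {v3, v4} = 0 \<Longrightarrow>
      z {v4, v0} = 0 \<Longrightarrow> P \<subseteq> S \<Longrightarrow> card P = 2 \<Longrightarrow> z P = 0"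
proof -
  have triple: "pair_sum z S (S - {x, y, w}) = z {x, y} + z {x, w} + z {y, w}"
    if "distinct [x, y, w]" "{x, y, w} \<subseteq> S" for x y w
    using that sum_pairs_of_triple[of x y w z] by (simp add: pair_sum_def double_diff)
  have tri: "pair_sum z S {v0, v1} = z {v2, v3} + z {v2, v4} + z {v3, v4}"
    "pair_sum z S {v0, v2} = z {v1, v3} + z {v4, v1} + z {v3, v4}"
    "pair_sum z S {v1, v3} = z {v0, v2} + z {v2, v4} + z {v4, v0}"
    "pair_sum z S {v2, v4} = z {v0, v1} + z {v3, v0} + z {v1, v3}"
    "pair_sum z S {v3, v0} = z {v1, v2} + z {v4, v1} + z {v2, v4}"
    "pair_sum z S {v4, v1} = z {v0, v2} + z {v3, v0} + z {v2, v3}"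
    using dist triple[of v2 v3 v4] triple[of v1 v3 v4] triple[of v0 v2 v4] triple[of v0 v1 v3]
      triple[of v1 v2 v4] triple[of v0 v2 v3]
    by (auto simp: S insert_Diff_if insert_commute)
  show ?edge using tri diag by linarith
  show "z P = 0" if edges: "z {v0, v1} = 0" "z {v1, v2} = 0" "z {v2, v3} = 0" "z {v3, v4} = 0"
    "z {v4, v0} = 0" and P: "P \<subseteq> S" "card P = 2"
  proof -
    have "z {v0, v2} = 0" "z {v1, v3} = 0" "z {v2, v4} = 0" "z {v3, v0} = 0" "z {v4, v1} = 0"
      using tri diag edges by linarith+
    moreover obtain x y where "P = {x, y}" "x \<noteq> y" "x \<in> S" "y \<in> S"
      using P by (auto simp: card_2_iff)
    ultimately show ?thesis
      using edges unfolding S by (auto simp: insert_commute)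
  qed
qed

definition permute_by :: "nat list \<Rightarrow> nat \<Rightarrow> nat" where
  "permute_by xs v = (if v < length xs then xs ! v else v)"

text \<open>
For a concrete list the two hypotheses are decided by evaluation.
\<close>

lemma permute_by_involutive:
  assumes "list_all (\<lambda>v. v < length xs) xs" "map ((!) xs) xs = [0..<length xs]"
  shows "permute_by xs (permute_by xs v) = v"
  using assms(1) arg_cong[OF assms(2), of "\<lambda>ys. ys ! v"]
  by (auto simp: permute_by_def list_all_length)

lemma permute_by_commute:
  assumes "length ys = length xs" "list_all (\<lambda>v. v < length xs) xs"
    "list_all (\<lambda>v. v < length xs) ys"
    and "map ((!) xs) ys = map ((!) ys) xs"
  shows "permute_by xs (permute_by ys v) = permute_by ys (permute_by xs v)"
  using assms(1-3) arg_cong[OF assms(4), of "\<lambda>zs. zs ! v"]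
  by (auto simp: permute_by_def list_all_length)

text \<open>
The reflections of the dodecahedron in three mutually orthogonal planes. Together they generate a
group of order eight, whose orbits on vertices, edges and faces are represented by the vertices
\<open>1\<close>, \<open>8\<close>, \<open>4\<close>, \<open>3\<close>, the edges \<open>{1,2}\<close>, \<open>{8,20}\<close>, \<open>{4,9}\<close>, \<open>{1,5}\<close>, \<open>{3,8}\<close>, \<open>{3,4}\<close> and the faces
\<open>{1,2,3,4,5}\<close>, \<open>{2,3,7,8,20}\<close>, \<open>{3,4,8,9,16}\<close>.
\<close>

definition rho1 :: "nat \<Rightarrow> nat" where
  "rho1 = permute_by [0,1,2,7,19,6,5,3,20,14,18,11,12,17,9,16,15,13,10,4,8]"

definition rho2 :: "nat \<Rightarrow> nat" where
  "rho2 = permute_by [0,2,1,5,4,3,7,6,10,9,8,12,11,15,14,13,17,16,20,19,18]"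

definition rho3 :: "nat \<Rightarrow> nat" where
  "rho3 = permute_by [0,12,11,16,9,17,13,15,8,4,10,2,1,6,19,7,3,5,18,14,20]"

lemma rho_involutive: "rho1 (rho1 v) = v" "rho2 (rho2 v) = v" "rho3 (rho3 v) = v"
  unfolding rho1_def rho2_def rho3_def by (rule permute_by_involutive; code_simp)+

lemma rho_commute:
  "rho1 (rho2 v) = rho2 (rho1 v)" "rho1 (rho3 v) = rho3 (rho1 v)" "rho2 (rho3 v) = rho3 (rho2 v)"
  unfolding rho1_def rho2_def rho3_def by (rule permute_by_commute; code_simp)+

text \<open>
The vertices \<open>4\<close>, \<open>9\<close>, \<open>14\<close>, \<open>19\<close> form one orbit under the three reflections. With equal values at all
vertices the systems for \<open>k = 1\<close> and \<open>k = 2\<close> would both be singular. The negative sign makes the sum of the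
face weights negative, since \<open>s = 5\<close> is odd.
\<close>

definition dodecahedron_weights :: "nat \<Rightarrow> real" where
  "dodecahedron_weights v = (if v \<in> {4,9,14,19} then - 2 else - 1)"

lemma face_weight_dodecahedron:
  "face_weight dodecahedron_weights {1,2,3,4,5} = - 2"
  "face_weight dodecahedron_weights {1,2,6,7,19} = - 2"
  "face_weight dodecahedron_weights {2,3,7,8,20} = - 1"
  "face_weight dodecahedron_weights {3,4,8,9,16} = - 4"
  "face_weight dodecahedron_weights {4,5,9,10,17} = - 4"
  "face_weight dodecahedron_weights {1,5,6,10,18} = - 1"
  "face_weight dodecahedron_weights {11,12,13,14,15} = - 2"
  "face_weight dodecahedron_weights {11,12,16,17,9} = - 2"
  "face_weight dodecahedron_weights {12,13,17,18,10} = - 1"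
  "face_weight dodecahedron_weights {13,14,18,19,6} = - 4"
  "face_weight dodecahedron_weights {14,15,19,20,7} = - 4"
  "face_weight dodecahedron_weights {11,15,16,20,8} = - 1"
  by (simp_all add: face_weight_def dodecahedron_weights_def)

text \<open>
The equations of the six edge representatives, for solutions with parity \<open>e\<^sub>i\<close> under the \<open>i\<close>-th
reflection. The relations \<open>x = e\<^sub>i x\<close> come from the reflections that map a representative to itself.
\<close>

lemma dodecahedron_edge_blocks:
  fixes e1 e2 e3 x1 x2 x3 x4 x5 x6 :: real
  assumes "e1 = 1 \<or> e1 = - 1" "e2 = 1 \<or> e2 = - 1" "e3 = 1 \<or> e3 = - 1"
    and "x1 = e1 * x1"
    and "x1 = e2 * x1"
    and "x2 = e1 * x2"
    and "x2 = e3 * x2"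
    and "x3 = e2 * x3"
    and "x3 = e3 * x3"
    and "6 * x6 + 6 * e2 * x6 - 4 * x1 - 2 * e2 * x4 - 2 * x4 + 6 * e1 * x6 + 6 * e1 * e2 * x6
      - 2 * e1 * e2 * x4 - 2 * e1 * x4 = 0"
    and "3 * e1 * e2 * x4 + 3 * e2 * x4 - 2 * x2 - e1 * x5 - x5 + 3 * e1 * e2 * e3 * x4
      + 3 * e2 * e3 * x4 - e1 * e3 * x5 - e3 * x5 = 0"
    and "12 * e3 * x5 + 12 * x5 - 8 * x3 - 4 * e3 * x6 - 4 * x6 + 12 * e2 * e3 * x5
      + 12 * e2 * x5 - 4 * e2 * e3 * x6 - 4 * e2 * x6 = 0"
    and "6 * x6 + 6 * e2 * x4 - 3 * x4 - 2 * e2 * x6 - 2 * x1 + 3 * e2 * x2 + 3 * e1 * e2 * x5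
      - e2 * x5 - e1 * x4 = 0"
    and "3 * e1 * x5 + 3 * e1 * e2 * x4 - 5 * x5 - x2 - e2 * x4 + 12 * e3 * x6 + 12 * x3
      - 4 * e3 * x5 - 4 * x6 = 0"
    and "6 * x4 + 6 * x1 - 6 * x6 - 2 * e2 * x6 - 2 * e2 * x4 + 12 * e3 * x6 + 12 * e3 * x5
      - 4 * x3 - 4 * x5 = 0"
  shows "x1 = 0 \<and> x2 = 0 \<and> x3 = 0 \<and> x4 = 0 \<and> x5 = 0 \<and> x6 = 0"
  using assms(1-3)
  by (elim disjE; intro conjI; use assms(4-) in \<open>simp; linarith?\<close>)

text \<open>
The same for the four vertex representatives and the system for \<open>k = 1\<close>.
\<close>

lemma dodecahedron_vertex_blocks:
  fixes e1 e2 e3 x1 x2 x3 x4 :: real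
  assumes "e1 = 1 \<or> e1 = - 1" "e2 = 1 \<or> e2 = - 1" "e3 = 1 \<or> e3 = - 1"
    and "x1 = e1 * x1"
    and "x2 = e3 * x2"
    and "x3 = e2 * x3"
    and "4 * e2 * x1 + 2 * x4 + 2 * x3 + 3 * e2 * x4 + 3 * e1 * e2 * x4 + 2 * e1 * x4
      + 2 * e1 * x3 + e2 * x2 + e1 * e2 * x2 = 0"
    and "e2 * x1 + 5 * x4 + e1 * x4 + 2 * e1 * x2 + 4 * x3 + 4 * e3 * x3 + 5 * e3 * x4
      + e2 * e3 * x1 + e1 * e3 * x4 = 0"
    and "2 * x1 + 2 * e2 * x1 + 6 * x4 + 6 * e2 * x4 + 4 * x2 + 8 * e3 * x3 + 4 * e3 * x4
      + 4 * e2 * x2 + 4 * e2 * e3 * x4 = 0"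
    and "2 * x1 + 3 * e2 * x1 + 6 * x3 + 2 * e2 * x4 + e1 * x4 + 5 * x2 + e1 * x2 + 4 * e3 * x3
      + 4 * e3 * x4 = 0"
  shows "x1 = 0 \<and> x2 = 0 \<and> x3 = 0 \<and> x4 = 0"
  using assms(1-3)
  by (elim disjE; intro conjI; use assms(4-) in \<open>simp; linarith?\<close>)

lemma face_symmetry_dodecahedron:
  assumes "r \<in> {rho1, rho2, rho3}"
  shows "facets.face_symmetry (vertices Dodecahedron) (faces Dodecahedron) dodecahedron_weights r"
proof -
  interpret facets "vertices Dodecahedron" "faces Dodecahedron" 5
    using facets_platonic[of Dodecahedron] by simp
  have inv: "r (r v) = v" for v using assms rho_involutive by auto
  have faces: "\<forall>S\<in>faces Dodecahedron. r ` S \<in> faces Dodecahedron"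
  proof
    fix S assume "S \<in> faces Dodecahedron"
    with assms show "r ` S \<in> faces Dodecahedron"
      unfolding faces.simps
      by (elim insertE emptyE)
         (simp_all add: rho1_def rho2_def rho3_def permute_by_def insert_commute)
  qed
  have vert: "r v \<in> vertices Dodecahedron \<and> dodecahedron_weights (r v) = dodecahedron_weights v"
    if "v \<in> vertices Dodecahedron" for v
  proof -
    have "v \<in> {1,2,3,4,5,6,7,8,9,10,11,12,13,14,15,16,17,18,19,20}"
      using that unfolding vertices.simps atLeastAtMost_iff insert_iff empty_iff by presburger
    with assms show ?thesis
      by (elim insertE emptyE)
         (simp_all add: rho1_def rho2_def rho3_def permute_by_def dodecahedron_weights_def)
  qed
  show ?thesis
    unfolding face_symmetry_def using inv faces vert by blast
qed

text \<open>
The parities express all unknowns by those of the orbit representatives, whose four equations are then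
those of \<open>dodecahedron_vertex_blocks\<close>.
\<close>

lemma dodecahedron_vertices_vanish:
  assumes sys: "facets.weight_system (vertices Dodecahedron) (faces Dodecahedron) dodecahedron_weights 1 z"
    and e: "e1 = 1 \<or> e1 = - 1" "e2 = 1 \<or> e2 = - 1" "e3 = 1 \<or> e3 = - 1"
    and p1: "\<And>P. z (rho1 ` P) = e1 * z P" and p2: "\<And>P. z (rho2 ` P) = e2 * z P"
    and p3: "\<And>P. z (rho3 ` P) = e3 * z P"
    and v: "v \<in> vertices Dodecahedron"
  shows "z {v} = 0"
proof -
  interpret facets "vertices Dodecahedron" "faces Dodecahedron" 5
    using facets_platonic[of Dodecahedron] by simp
  note eqs = weight_system_1[OF sys, unfolded sum_faces face_weight_dodecahedron]
  \<comment> \<open>A fact \<open>y_v\<close> gives \<open>z\<close> at \<open>v\<close> by its value at the representative of the orbit.\<close>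
  have y_2: "z {2} = e2 * z {1}"
    using p2[of "{1}"] by (simp add: rho2_def permute_by_def insert_commute)
  have y_12: "z {12} = e3 * z {1}"
    using p3[of "{1}"] by (simp add: rho3_def permute_by_def insert_commute)
  have y_11: "z {11} = e2 * e3 * z {1}"
    using p3[of "{2}"] y_2 by (simp add: rho3_def permute_by_def insert_commute)
  have y_20: "z {20} = e1 * z {8}"
    using p1[of "{8}"] by (simp add: rho1_def permute_by_def insert_commute)
  have y_10: "z {10} = e2 * z {8}"
    using p2[of "{8}"] by (simp add: rho2_def permute_by_def insert_commute)
  have y_18: "z {18} = e1 * e2 * z {8}"
    using p2[of "{20}"] y_20 by (simp add: rho2_def permute_by_def insert_commute)
  have y_19: "z {19} = e1 * z {4}"
    using p1[of "{4}"] by (simp add: rho1_def permute_by_def insert_commute)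
  have y_9: "z {9} = e3 * z {4}"
    using p3[of "{4}"] by (simp add: rho3_def permute_by_def insert_commute)
  have y_14: "z {14} = e1 * e3 * z {4}"
    using p3[of "{19}"] y_19 by (simp add: rho3_def permute_by_def insert_commute)
  have y_7: "z {7} = e1 * z {3}"
    using p1[of "{3}"] by (simp add: rho1_def permute_by_def insert_commute)
  have y_5: "z {5} = e2 * z {3}"
    using p2[of "{3}"] by (simp add: rho2_def permute_by_def insert_commute)
  have y_16: "z {16} = e3 * z {3}"
    using p3[of "{3}"] by (simp add: rho3_def permute_by_def insert_commute)
  have y_6: "z {6} = e1 * e2 * z {3}"
    using p2[of "{7}"] y_7 by (simp add: rho2_def permute_by_def insert_commute)
  have y_15: "z {15} = e1 * e3 * z {3}"
    using p3[of "{7}"] y_7 by (simp add: rho3_def permute_by_def insert_commute)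
  have y_17: "z {17} = e2 * e3 * z {3}"
    using p3[of "{5}"] y_5 by (simp add: rho3_def permute_by_def insert_commute)
  have y_13: "z {13} = e1 * e2 * e3 * z {3}"
    using p3[of "{6}"] y_6 by (simp add: rho3_def permute_by_def insert_commute)
  have s1_1: "z {1} = e1 * z {1}"
    using p1[of "{1}"] by (simp add: rho1_def permute_by_def insert_commute)
  have s3_8: "z {8} = e3 * z {8}"
    using p3[of "{8}"] by (simp add: rho3_def permute_by_def insert_commute)
  have s2_4: "z {4} = e2 * z {4}"
    using p2[of "{4}"] by (simp add: rho2_def permute_by_def insert_commute)
  have q_1: "4 * e2 * z {1} + 2 * z {3} + 2 * z {4} + 3 * e2 * z {3} + 3 * e1 * e2 * z {3}
    + 2 * e1 * z {3} + 2 * e1 * z {4} + e2 * z {8} + e1 * e2 * z {8} = 0"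
    using eqs[of 1] by (simp add: insert_Diff_if y_2 y_5 y_6 y_7 y_19 y_10 y_18)
  have q_8: "e2 * z {1} + 5 * z {3} + e1 * z {3} + 2 * e1 * z {8} + 4 * z {4} + 4 * e3 * z {4}
    + 5 * e3 * z {3} + e2 * e3 * z {1} + e1 * e3 * z {3} = 0"
    using eqs[of 8] by (simp add: insert_Diff_if y_2 y_7 y_20 y_9 y_16 y_11 y_15)
  have q_4: "2 * z {1} + 2 * e2 * z {1} + 6 * z {3} + 6 * e2 * z {3} + 4 * z {8}
    + 8 * e3 * z {4} + 4 * e3 * z {3} + 4 * e2 * z {8} + 4 * e2 * e3 * z {3} = 0"
    using eqs[of 4] by (simp add: insert_Diff_if y_2 y_5 y_9 y_16 y_10 y_17)
  have q_3: "2 * z {1} + 3 * e2 * z {1} + 6 * z {4} + 2 * e2 * z {3} + e1 * z {3} + 5 * z {8}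
    + e1 * z {8} + 4 * e3 * z {4} + 4 * e3 * z {3} = 0"
    using eqs[of 3] by (simp add: insert_Diff_if y_2 y_5 y_7 y_20 y_9 y_16)
  have reps: "z {1} = 0 \<and> z {8} = 0 \<and> z {4} = 0 \<and> z {3} = 0"
    by (rule dodecahedron_vertex_blocks[OF e s1_1 s3_8 s2_4 q_1 q_8 q_4 q_3])
  have "v \<in> {1,2,3,4,5,6,7,8,9,10,11,12,13,14,15,16,17,18,19,20}"
    using v unfolding vertices.simps atLeastAtMost_iff insert_iff empty_iff by presburger
  then show ?thesis
    using reps by (elim insertE emptyE) (simp_all add: y_2 y_5 y_6 y_7 y_9 y_10 y_11 y_12 y_13
      y_14 y_15 y_16 y_17 y_18 y_19 y_20)
qed

text \<open>
The diagonals are eliminated in each pentagon at an edge representative. The remaining equations of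
these edges are those of \<open>dodecahedron_edge_blocks\<close>; once the edges vanish, so do the
diagonals of three representative pentagons, and the reflections carry this to all faces.
\<close>

lemma dodecahedron_pairs_vanish:
  assumes sys: "facets.weight_system (vertices Dodecahedron) (faces Dodecahedron) dodecahedron_weights 2 z"
    and e: "e1 = 1 \<or> e1 = - 1" "e2 = 1 \<or> e2 = - 1" "e3 = 1 \<or> e3 = - 1"
    and p1: "\<And>P. z (rho1 ` P) = e1 * z P" and p2: "\<And>P. z (rho2 ` P) = e2 * z P"
    and p3: "\<And>P. z (rho3 ` P) = e3 * z P"
    and S: "S \<in> faces Dodecahedron" and P: "P \<subseteq> S" "card P = 2"
  shows "z P = 0"
proof -
  interpret facets "vertices Dodecahedron" "faces Dodecahedron" 5
    using facets_platonic[of Dodecahedron] by simp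
  have eqs: "(\<Sum>S\<in>faces Dodecahedron. if Q \<subseteq> S
      then face_weight dodecahedron_weights S * pair_sum z S Q else 0) = 0"
    if "Q \<subseteq> {1..20}" "card Q = 2" for Q
    using sys that unfolding weight_system_def pair_sum_def by simp
  note eqs = eqs[unfolded sum_faces face_weight_dodecahedron]
  \<comment> \<open>A fact \<open>y_u_v\<close> gives \<open>z\<close> at an edge by its value at the representative of the orbit.\<close>
  have y_10_18: "z {10,18} = e2 * z {8,20}"
    using p2[of "{8,20}"] by (simp add: rho2_def permute_by_def insert_commute)
  have y_1_6: "z {1,6} = e1 * z {1,5}"
    using p1[of "{1,5}"] by (simp add: rho1_def permute_by_def insert_commute)
  have y_2_3: "z {2,3} = e2 * z {1,5}"
    using p2[of "{1,5}"] by (simp add: rho2_def permute_by_def insert_commute)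
  have y_2_7: "z {2,7} = e1 * e2 * z {1,5}"
    using p2[of "{1,6}"] y_1_6 by (simp add: rho2_def permute_by_def insert_commute)
  have y_11_16: "z {11,16} = e2 * e3 * z {1,5}"
    using p3[of "{2,3}"] y_2_3 by (simp add: rho3_def permute_by_def insert_commute)
  have y_11_15: "z {11,15} = e1 * e2 * e3 * z {1,5}"
    using p3[of "{2,7}"] y_2_7 by (simp add: rho3_def permute_by_def insert_commute)
  have y_7_20: "z {7,20} = e1 * z {3,8}"
    using p1[of "{3,8}"] by (simp add: rho1_def permute_by_def insert_commute)
  have y_5_10: "z {5,10} = e2 * z {3,8}"
    using p2[of "{3,8}"] by (simp add: rho2_def permute_by_def insert_commute)
  have y_8_16: "z {8,16} = e3 * z {3,8}"
    using p3[of "{3,8}"] by (simp add: rho3_def permute_by_def insert_commute)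
  have y_6_18: "z {6,18} = e1 * e2 * z {3,8}"
    using p2[of "{7,20}"] y_7_20 by (simp add: rho2_def permute_by_def insert_commute)
  have y_15_20: "z {15,20} = e1 * e3 * z {3,8}"
    using p3[of "{7,20}"] y_7_20 by (simp add: rho3_def permute_by_def insert_commute)
  have y_10_17: "z {10,17} = e2 * e3 * z {3,8}"
    using p3[of "{5,10}"] y_5_10 by (simp add: rho3_def permute_by_def insert_commute)
  have y_7_19: "z {7,19} = e1 * z {3,4}"
    using p1[of "{3,4}"] by (simp add: rho1_def permute_by_def insert_commute)
  have y_4_5: "z {4,5} = e2 * z {3,4}"
    using p2[of "{3,4}"] by (simp add: rho2_def permute_by_def insert_commute)
  have y_9_16: "z {9,16} = e3 * z {3,4}"
    using p3[of "{3,4}"] by (simp add: rho3_def permute_by_def insert_commute)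
  have y_6_19: "z {6,19} = e1 * e2 * z {3,4}"
    using p2[of "{7,19}"] y_7_19 by (simp add: rho2_def permute_by_def insert_commute)
  have y_9_17: "z {9,17} = e2 * e3 * z {3,4}"
    using p3[of "{4,5}"] y_4_5 by (simp add: rho3_def permute_by_def insert_commute)
  have s1_1_2: "z {1,2} = e1 * z {1,2}"
    using p1[of "{1,2}"] by (simp add: rho1_def permute_by_def insert_commute)
  have s2_1_2: "z {1,2} = e2 * z {1,2}"
    using p2[of "{1,2}"] by (simp add: rho2_def permute_by_def insert_commute)
  have s1_8_20: "z {8,20} = e1 * z {8,20}"
    using p1[of "{8,20}"] by (simp add: rho1_def permute_by_def insert_commute)
  have s3_8_20: "z {8,20} = e3 * z {8,20}"
    using p3[of "{8,20}"] by (simp add: rho3_def permute_by_def insert_commute)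
  have s2_4_9: "z {4,9} = e2 * z {4,9}"
    using p2[of "{4,9}"] by (simp add: rho2_def permute_by_def insert_commute)
  have s3_4_9: "z {4,9} = e3 * z {4,9}"
    using p3[of "{4,9}"] by (simp add: rho3_def permute_by_def insert_commute)
  \<comment> \<open>The equations of the diagonals, in the seven pentagons that contain an edge representative.\<close>
  have d0: "pair_sum z {1,2,3,4,5} {1,3} = 0" "pair_sum z {1,2,3,4,5} {1,4} = 0"
    "pair_sum z {1,2,3,4,5} {2,4} = 0" "pair_sum z {1,2,3,4,5} {2,5} = 0"
      "pair_sum z {1,2,3,4,5} {3,5} = 0"
    using eqs[of "{1,3}"] eqs[of "{1,4}"] eqs[of "{2,4}"] eqs[of "{2,5}"] eqs[of "{3,5}"]
    by simp_all
  have d1: "pair_sum z {1,2,6,7,19} {1,7} = 0" "pair_sum z {1,2,6,7,19} {1,19} = 0"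
    "pair_sum z {1,2,6,7,19} {2,6} = 0" "pair_sum z {1,2,6,7,19} {2,19} = 0"
      "pair_sum z {1,2,6,7,19} {6,7} = 0"
    using eqs[of "{1,7}"] eqs[of "{1,19}"] eqs[of "{2,6}"] eqs[of "{2,19}"] eqs[of "{6,7}"]
    by simp_all
  have d2: "pair_sum z {2,3,7,8,20} {2,8} = 0" "pair_sum z {2,3,7,8,20} {2,20} = 0"
    "pair_sum z {2,3,7,8,20} {3,7} = 0" "pair_sum z {2,3,7,8,20} {3,20} = 0"
      "pair_sum z {2,3,7,8,20} {7,8} = 0"
    using eqs[of "{2,8}"] eqs[of "{2,20}"] eqs[of "{3,7}"] eqs[of "{3,20}"] eqs[of "{7,8}"]
    by simp_all
  have d3: "pair_sum z {3,4,8,9,16} {3,9} = 0" "pair_sum z {3,4,8,9,16} {3,16} = 0"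
    "pair_sum z {3,4,8,9,16} {4,8} = 0" "pair_sum z {3,4,8,9,16} {4,16} = 0"
      "pair_sum z {3,4,8,9,16} {8,9} = 0"
    using eqs[of "{3,9}"] eqs[of "{3,16}"] eqs[of "{4,8}"] eqs[of "{4,16}"] eqs[of "{8,9}"]
    by simp_all
  have d4: "pair_sum z {4,5,9,10,17} {4,10} = 0" "pair_sum z {4,5,9,10,17} {4,17} = 0"
    "pair_sum z {4,5,9,10,17} {5,9} = 0" "pair_sum z {4,5,9,10,17} {5,17} = 0"
      "pair_sum z {4,5,9,10,17} {9,10} = 0"
    using eqs[of "{4,10}"] eqs[of "{4,17}"] eqs[of "{5,9}"] eqs[of "{5,17}"] eqs[of "{9,10}"]
    by simp_all
  have d5: "pair_sum z {1,5,6,10,18} {1,10} = 0" "pair_sum z {1,5,6,10,18} {1,18} = 0"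
    "pair_sum z {1,5,6,10,18} {5,6} = 0" "pair_sum z {1,5,6,10,18} {5,18} = 0"
      "pair_sum z {1,5,6,10,18} {6,10} = 0"
    using eqs[of "{1,10}"] eqs[of "{1,18}"] eqs[of "{5,6}"] eqs[of "{5,18}"] eqs[of "{6,10}"]
    by simp_all
  have d11: "pair_sum z {11,15,16,20,8} {8,11} = 0" "pair_sum z {11,15,16,20,8} {8,15} = 0"
    "pair_sum z {11,15,16,20,8} {11,20} = 0" "pair_sum z {11,15,16,20,8} {15,16} = 0"
      "pair_sum z {11,15,16,20,8} {16,20} = 0"
    using eqs[of "{8,11}"] eqs[of "{8,15}"] eqs[of "{11,20}"] eqs[of "{15,16}"] eqs[of "{16,20}"]
    by simp_all
  \<comment> \<open>For each representative edge: its equation, the elimination of the diagonals in both adjacent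
    pentagons, and the result in terms of the representatives.\<close>
  have q_1_2: "2 * pair_sum z {1,2,3,4,5} {1,2} + 2 * pair_sum z {1,2,6,7,19} {1,2} = 0"
    using eqs[of "{1,2}"] by simp
  have f0_1_2: "2 * pair_sum z {1,2,3,4,5} {1,2} = 3 * z {3,4} + 3 * z {4,5} - z {1,2}
    - z {2,3} - z {1,5}"
    using pentagon_elimination(1)[of 1 2 3 4 5 "{1,2,3,4,5}" z] d0
    by (simp add: insert_commute)
  have f1_1_2: "2 * pair_sum z {1,2,6,7,19} {1,2} = 3 * z {7,19} + 3 * z {6,19} - z {1,2}
    - z {2,7} - z {1,6}"
    using pentagon_elimination(1)[of 1 2 7 19 6 "{1,2,6,7,19}" z] d1
    by (simp add: insert_commute)
  have b_1_2: "6 * z {3,4} + 6 * e2 * z {3,4} - 4 * z {1,2} - 2 * e2 * z {1,5} - 2 * z {1,5}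
    + 6 * e1 * z {3,4} + 6 * e1 * e2 * z {3,4} - 2 * e1 * e2 * z {1,5} - 2 * e1 * z {1,5} = 0"
    using q_1_2 f0_1_2 f1_1_2 y_4_5 y_2_3 y_7_19 y_6_19 y_2_7 y_1_6 by simp
  have q_8_20: "pair_sum z {2,3,7,8,20} {8,20} + pair_sum z {11,15,16,20,8} {8,20} = 0"
    using eqs[of "{8,20}"] by simp
  have f2_8_20: "2 * pair_sum z {2,3,7,8,20} {8,20} = 3 * z {2,7} + 3 * z {2,3} - z {8,20}
    - z {7,20} - z {3,8}"
    using pentagon_elimination(1)[of 8 20 7 2 3 "{2,3,7,8,20}" z] d2
    by (simp add: insert_commute)
  have f11_8_20: "2 * pair_sum z {11,15,16,20,8} {8,20} = 3 * z {11,15} + 3 * z {11,16}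
    - z {8,20} - z {15,20} - z {8,16}"
    using pentagon_elimination(1)[of 8 20 15 11 16 "{11,15,16,20,8}" z] d11
    by (simp add: insert_commute)
  have b_8_20: "3 * e1 * e2 * z {1,5} + 3 * e2 * z {1,5} - 2 * z {8,20} - e1 * z {3,8}
    - z {3,8} + 3 * e1 * e2 * e3 * z {1,5} + 3 * e2 * e3 * z {1,5} - e1 * e3 * z {3,8}
    - e3 * z {3,8} = 0"
    using q_8_20 f2_8_20 f11_8_20 y_2_7 y_2_3 y_7_20 y_11_15 y_11_16 y_15_20 y_8_16 by simp
  have q_4_9: "4 * pair_sum z {3,4,8,9,16} {4,9} + 4 * pair_sum z {4,5,9,10,17} {4,9} = 0"
    using eqs[of "{4,9}"] by simp
  have f3_4_9: "2 * pair_sum z {3,4,8,9,16} {4,9} = 3 * z {8,16} + 3 * z {3,8} - z {4,9}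
    - z {9,16} - z {3,4}"
    using pentagon_elimination(1)[of 4 9 16 8 3 "{3,4,8,9,16}" z] d3
    by (simp add: insert_commute)
  have f4_4_9: "2 * pair_sum z {4,5,9,10,17} {4,9} = 3 * z {10,17} + 3 * z {5,10} - z {4,9}
    - z {9,17} - z {4,5}"
    using pentagon_elimination(1)[of 4 9 17 10 5 "{4,5,9,10,17}" z] d4
    by (simp add: insert_commute)
  have b_4_9: "12 * e3 * z {3,8} + 12 * z {3,8} - 8 * z {4,9} - 4 * e3 * z {3,4} - 4 * z {3,4}
    + 12 * e2 * e3 * z {3,8} + 12 * e2 * z {3,8} - 4 * e2 * e3 * z {3,4} - 4 * e2 * z {3,4} = 0"
    using q_4_9 f3_4_9 f4_4_9 y_8_16 y_9_16 y_10_17 y_5_10 y_9_17 y_4_5 by simp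
  have q_1_5: "2 * pair_sum z {1,2,3,4,5} {1,5} + pair_sum z {1,5,6,10,18} {1,5} = 0"
    using eqs[of "{1,5}"] by simp
  have f0_1_5: "2 * pair_sum z {1,2,3,4,5} {1,5} = 3 * z {3,4} + 3 * z {2,3} - z {1,5}
    - z {4,5} - z {1,2}"
    using pentagon_elimination(1)[of 1 5 4 3 2 "{1,2,3,4,5}" z] d0
    by (simp add: insert_commute)
  have f5_1_5: "2 * pair_sum z {1,5,6,10,18} {1,5} = 3 * z {10,18} + 3 * z {6,18} - z {1,5}
    - z {5,10} - z {1,6}"
    using pentagon_elimination(1)[of 1 5 10 18 6 "{1,5,6,10,18}" z] d5
    by (simp add: insert_commute)
  have b_1_5: "6 * z {3,4} + 6 * e2 * z {1,5} - 3 * z {1,5} - 2 * e2 * z {3,4} - 2 * z {1,2}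
    + 3 * e2 * z {8,20} + 3 * e1 * e2 * z {3,8} - e2 * z {3,8} - e1 * z {1,5} = 0"
    using q_1_5 f0_1_5 f5_1_5 y_2_3 y_4_5 y_10_18 y_6_18 y_5_10 y_1_6 by simp
  have q_3_8: "pair_sum z {2,3,7,8,20} {3,8} + 4 * pair_sum z {3,4,8,9,16} {3,8} = 0"
    using eqs[of "{3,8}"] by simp
  have f2_3_8: "2 * pair_sum z {2,3,7,8,20} {3,8} = 3 * z {7,20} + 3 * z {2,7} - z {3,8}
    - z {8,20} - z {2,3}"
    using pentagon_elimination(1)[of 3 8 20 7 2 "{2,3,7,8,20}" z] d2
    by (simp add: insert_commute)
  have f3_3_8: "2 * pair_sum z {3,4,8,9,16} {3,8} = 3 * z {9,16} + 3 * z {4,9} - z {3,8}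
    - z {8,16} - z {3,4}"
    using pentagon_elimination(1)[of 3 8 16 9 4 "{3,4,8,9,16}" z] d3
    by (simp add: insert_commute)
  have b_3_8: "3 * e1 * z {3,8} + 3 * e1 * e2 * z {1,5} - 5 * z {3,8} - z {8,20} - e2 * z {1,5}
    + 12 * e3 * z {3,4} + 12 * z {4,9} - 4 * e3 * z {3,8} - 4 * z {3,4} = 0"
    using q_3_8 f2_3_8 f3_3_8 y_7_20 y_2_7 y_2_3 y_9_16 y_8_16 by simp
  have q_3_4: "2 * pair_sum z {1,2,3,4,5} {3,4} + 4 * pair_sum z {3,4,8,9,16} {3,4} = 0"
    using eqs[of "{3,4}"] by simp
  have f0_3_4: "2 * pair_sum z {1,2,3,4,5} {3,4} = 3 * z {1,5} + 3 * z {1,2} - z {3,4}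
    - z {4,5} - z {2,3}"
    using pentagon_elimination(1)[of 3 4 5 1 2 "{1,2,3,4,5}" z] d0
    by (simp add: insert_commute)
  have f3_3_4: "2 * pair_sum z {3,4,8,9,16} {3,4} = 3 * z {9,16} + 3 * z {8,16} - z {3,4}
    - z {4,9} - z {3,8}"
    using pentagon_elimination(1)[of 3 4 9 16 8 "{3,4,8,9,16}" z] d3
    by (simp add: insert_commute)
  have b_3_4: "6 * z {1,5} + 6 * z {1,2} - 6 * z {3,4} - 2 * e2 * z {3,4} - 2 * e2 * z {1,5}
    + 12 * e3 * z {3,4} + 12 * e3 * z {3,8} - 4 * z {4,9} - 4 * z {3,8} = 0"
    using q_3_4 f0_3_4 f3_3_4 y_4_5 y_2_3 y_9_16 y_8_16 by simp
  have reps: "z {1,2} = 0" "z {8,20} = 0" "z {4,9} = 0" "z {1,5} = 0" "z {3,8} = 0" "z {3,4} = 0"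
    using dodecahedron_edge_blocks[OF e s1_1_2 s2_1_2 s1_8_20 s3_8_20 s2_4_9 s3_4_9 b_1_2 b_8_20
      b_4_9 b_1_5 b_3_8 b_3_4] by blast+
  have move: "\<forall>P. P \<subseteq> r ` S \<longrightarrow> card P = 2 \<longrightarrow> z P = 0"
    if r: "r \<in> {rho1, rho2, rho3}" and S: "\<forall>P. P \<subseteq> S \<longrightarrow> card P = 2 \<longrightarrow> z P = 0" for r S
  proof (intro allI impI)
    fix P assume P: "P \<subseteq> r ` S" "card P = 2"
    have rr: "r (r v) = v" for v using r rho_involutive by auto
    then have "r ` P \<subseteq> S" using P(1) by (auto dest!: subsetD)
    moreover have "card (r ` P) = 2" using P(2) rr by (metis card_image inj_on_def)
    ultimately have "z (r ` P) = 0" using S by blast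
    then show "z P = 0" using r p1[of P] p2[of P] p3[of P] e by auto
  qed
  have F0: "\<forall>P. P \<subseteq> {1,2,3,4,5} \<longrightarrow> card P = 2 \<longrightarrow> z P = 0"
    using pentagon_elimination(2)[of 1 2 3 4 5 "{1,2,3,4,5}" z] d0 reps y_2_3 y_4_5
    by (simp add: insert_commute)
  have F2: "\<forall>P. P \<subseteq> {2,3,7,8,20} \<longrightarrow> card P = 2 \<longrightarrow> z P = 0"
    using pentagon_elimination(2)[of 2 3 8 20 7 "{2,3,7,8,20}" z] d2 reps y_2_3 y_7_20 y_2_7
    by (simp add: insert_commute)
  have F3: "\<forall>P. P \<subseteq> {3,4,8,9,16} \<longrightarrow> card P = 2 \<longrightarrow> z P = 0"
    using pentagon_elimination(2)[of 3 4 9 16 8 "{3,4,8,9,16}" z] d3 reps y_9_16 y_8_16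
    by (simp add: insert_commute)
  have F1: "\<forall>P. P \<subseteq> {1,2,6,7,19} \<longrightarrow> card P = 2 \<longrightarrow> z P = 0"
    using move[of rho1, OF _ F0] by (simp add: rho1_def permute_by_def insert_commute)
  have F7: "\<forall>P. P \<subseteq> {11,12,16,17,9} \<longrightarrow> card P = 2 \<longrightarrow> z P = 0"
    using move[of rho3, OF _ F0] by (simp add: rho3_def permute_by_def insert_commute)
  have F5: "\<forall>P. P \<subseteq> {1,5,6,10,18} \<longrightarrow> card P = 2 \<longrightarrow> z P = 0"
    using move[of rho2, OF _ F2] by (simp add: rho2_def permute_by_def insert_commute)
  have F11: "\<forall>P. P \<subseteq> {11,15,16,20,8} \<longrightarrow> card P = 2 \<longrightarrow> z P = 0"
    using move[of rho3, OF _ F2] by (simp add: rho3_def permute_by_def insert_commute)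
  have F10: "\<forall>P. P \<subseteq> {14,15,19,20,7} \<longrightarrow> card P = 2 \<longrightarrow> z P = 0"
    using move[of rho1, OF _ F3] by (simp add: rho1_def permute_by_def insert_commute)
  have F4: "\<forall>P. P \<subseteq> {4,5,9,10,17} \<longrightarrow> card P = 2 \<longrightarrow> z P = 0"
    using move[of rho2, OF _ F3] by (simp add: rho2_def permute_by_def insert_commute)
  have F6: "\<forall>P. P \<subseteq> {11,12,13,14,15} \<longrightarrow> card P = 2 \<longrightarrow> z P = 0"
    using move[of rho3, OF _ F1] by (simp add: rho3_def permute_by_def insert_commute)
  have F8: "\<forall>P. P \<subseteq> {12,13,17,18,10} \<longrightarrow> card P = 2 \<longrightarrow> z P = 0"
    using move[of rho3, OF _ F5] by (simp add: rho3_def permute_by_def insert_commute)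
  have F9: "\<forall>P. P \<subseteq> {13,14,18,19,6} \<longrightarrow> card P = 2 \<longrightarrow> z P = 0"
    using move[of rho2, OF _ F10] by (simp add: rho2_def permute_by_def insert_commute)
  show ?thesis
    using S P F0 F1 F2 F3 F4 F5 F6 F7 F8 F9 F10 F11
    unfolding faces.simps by (elim insertE emptyE) simp_all
qed

lemma dodecahedron_lefschetz_without_hodge_riemann:
  shows "strong_lefschetz_element (vertices Dodecahedron) (facet_poly (faces Dodecahedron))
      (cls (vertices Dodecahedron) (facet_poly (faces Dodecahedron))
        (linear_form (vertices Dodecahedron) dodecahedron_weights))" (is ?SL)
    and "\<not> hodge_riemann_relation (vertices Dodecahedron) (facet_poly (faces Dodecahedron))
      (cls (vertices Dodecahedron) (facet_poly (faces Dodecahedron))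
        (linear_form (vertices Dodecahedron) dodecahedron_weights))" (is ?HR)
proof -
  interpret facets "vertices Dodecahedron" "faces Dodecahedron" 5
    using facets_platonic[of Dodecahedron] by simp
  let ?a = dodecahedron_weights
  have total: "(\<Sum>S\<in>faces Dodecahedron. face_weight ?a S) < 0"
    unfolding sum_faces face_weight_dodecahedron by simp
  show ?HR by (rule not_hodge_riemann_of_negative[OF total])
  have vanish: "z P\<^sub>0 = 0"
    if "weight_system ?a k z"
      and "\<And>y e1 e2 e3. weight_system ?a k y \<Longrightarrow> e1 = 1 \<or> e1 = - 1 \<Longrightarrow> e2 = 1 \<or> e2 = - 1 \<Longrightarrow>
        e3 = 1 \<or> e3 = - 1 \<Longrightarrow> (\<And>P. y (rho1 ` P) = e1 * y P) \<Longrightarrow> (\<And>P. y (rho2 ` P) = e2 * y P) \<Longrightarrow>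
        (\<And>P. y (rho3 ` P) = e3 * y P) \<Longrightarrow> y P\<^sub>0 = 0" for k z P\<^sub>0
  proof (rule weight_system_vanish_by_parity[where R = "{rho1, rho2, rho3}"])
    fix y
    assume y: "weight_system ?a k y"
      "\<And>r. r \<in> {rho1, rho2, rho3} \<Longrightarrow> \<exists>e\<in>{1, - 1}. \<forall>P. y (r ` P) = e * y P"
    show "y P\<^sub>0 = 0"
      using y(2)[of rho1] y(2)[of rho2] y(2)[of rho3] that(2)[OF y(1)] by blast
  qed (use face_symmetry_dodecahedron rho_commute that(1) in auto)
  show ?SL
  proof (rule strong_lefschetz_of_weights)
    show "?a v \<noteq> 0" for v by (simp add: dodecahedron_weights_def)
  next
    fix k z S P
    assume k: "2 * k < (5::nat)" and sys: "weight_system ?a k z"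
      and SP: "S \<in> faces Dodecahedron" "P \<subseteq> S" "card P = k"
    consider "k = 0" | "k = 1" | "k = 2" using k by linarith
    then show "z P = 0"
    proof cases
      case 1
      then have "P = {}" using SP finite_subset[OF _ finite_facet] by auto
      then show ?thesis using weight_system_0[of ?a z] sys 1 total by simp
    next
      case 2
      then obtain v where v: "P = {v}" using SP by (auto simp: card_1_singleton_iff)
      show ?thesis
        using sys[unfolded 2]
      proof (rule vanish)
        fix z e1 e2 e3
        assume "weight_system ?a 1 z" "e1 = 1 \<or> e1 = - 1" "e2 = 1 \<or> e2 = - 1"
          "e3 = 1 \<or> e3 = - 1"
          "\<And>P. z (rho1 ` P) = e1 * z P" "\<And>P. z (rho2 ` P) = e2 * z P" "\<And>P. z (rho3 ` P) = e3 * z P"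
        note * = this
        have "v \<in> vertices Dodecahedron" using SP v facet_subset by blast
        then show "z P = 0"
          unfolding v by (rule dodecahedron_vertices_vanish[OF *])
      qed
    next
      case 3
      show ?thesis
        using sys[unfolded 3]
      proof (rule vanish)
        fix z e1 e2 e3
        assume "weight_system ?a 2 z" "e1 = 1 \<or> e1 = - 1" "e2 = 1 \<or> e2 = - 1"
          "e3 = 1 \<or> e3 = - 1"
          "\<And>P. z (rho1 ` P) = e1 * z P" "\<And>P. z (rho2 ` P) = e2 * z P" "\<And>P. z (rho3 ` P) = e3 * z P"
        note * = this
        show "z P = 0"
          using SP 3 by (intro dodecahedron_pairs_vanish[OF * SP(1,2)]) simp
      qed
    qed
  qed
qed

section \<open>The five Platonic solids\<close>

theorem theorem1p1:
  shows "(\<forall>P. strong_lefschetz_property (vertices P) (face_poly P)) \<and>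
    (\<forall>P\<in>{Tetrahedron, Octahedron}. \<forall>a :: nat \<Rightarrow> real. (\<forall>v\<in>vertices P. a v > 0) \<longrightarrow>
       hodge_riemann_relation (vertices P) (face_poly P)
         (cls (vertices P) (face_poly P) (linear_form (vertices P) a))) \<and>
    (\<forall>P\<in>{Hexahedron, Dodecahedron, Icosahedron}.
       \<exists>l. strong_lefschetz_element (vertices P) (face_poly P) l \<and>
         \<not> hodge_riemann_relation (vertices P) (face_poly P) l)"
proof -
  have HR: "\<forall>P\<in>{Tetrahedron, Octahedron}. \<forall>a :: nat \<Rightarrow> real. (\<forall>v\<in>vertices P. a v > 0) \<longrightarrow>
      hodge_riemann_relation (vertices P) (face_poly P)
        (cls (vertices P) (face_poly P) (linear_form (vertices P) a))"
    unfolding face_poly_eq using hodge_riemann_tetrahedron hodge_riemann_octahedron by blast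
  have SL: "\<forall>P\<in>{Hexahedron, Dodecahedron, Icosahedron}.
      \<exists>l. strong_lefschetz_element (vertices P) (face_poly P) l \<and>
        \<not> hodge_riemann_relation (vertices P) (face_poly P) l"
    unfolding face_poly_eq
    using hexahedron_lefschetz_without_hodge_riemann dodecahedron_lefschetz_without_hodge_riemann
      icosahedron_lefschetz_without_hodge_riemann
    by blast
  have "strong_lefschetz_property (vertices P) (face_poly P)" for P
  proof (cases "P \<in> {Tetrahedron, Octahedron}")
    case True
    interpret facets "vertices P" "faces P" "face_size P" by (rule facets_platonic)
    have "hodge_riemann_relation (vertices P) (facet_poly (faces P))
        (cls (vertices P) (facet_poly (faces P)) (linear_form (vertices P) (\<lambda>_. 1)))"
      using bspec[OF HR True] unfolding face_poly_eq by simp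
    then show ?thesis
      unfolding strong_lefschetz_property_def face_poly_eq
      using strong_lefschetz_of_hodge_riemann by blast
  next
    case False
    then have "P \<in> {Hexahedron, Dodecahedron, Icosahedron}" by (cases P) auto
    then show ?thesis using SL unfolding strong_lefschetz_property_def by blast
  qed
  with HR SL show ?thesis by blast
qed

end
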